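(* Fix $\eta>0$ and constants $C_{\rm comp},C_{\rm box},C_{\rm d}\ge1$, and let $A_{\rm ang}=A_{\rm ang}(\alpha)\ge2$, $B_{\rm ang}=B_{\rm ang}(\alpha)\ge2$ be functions of $\alpha\in(0,1]$ with $$\log A_{\rm ang}+\log B_{\rm ang}=o(\log\alpha^{-1})\quad(\alpha\to0),\qquad\frac{A_{\rm ang}}{\log^{C}(2/\alpha)}\longrightarrow\infty\ \text{ for every fixed }C .$$ Then there are $\alpha_0>0$, constants $C'\ge1$ and $c_{\rm fill}\in(0,1]$, and a function $\omega(\alpha)\to0$ such that the following holds for $0<\alpha\le\alpha_0$ and $\alpha\le\rho\le1$. Let $(\mathcal P,Y)$ be a finite labelled multiset of $C_{\rm box}$-comparable rectangular $\alpha\times\rho\times1$ planks contained in a fixed unit ball, with measurable shadings (coincident carriers, possibly with different ordered frames, allowed), such that $$|\mathcal P|\le\alpha^{-C_{\rm comp}},\qquad\lambda(\mathcal P,Y)\ge\alpha^{\eta},\qquad\mu(\mathcal P,Y)\ge\alpha^{-\eta}.$$ Let $m>0$ and suppose $\sum_{P}\mathbf 1_{Y(P)}(x)\in[m,2m)$ at every point $x$ of $U(\mathcal P,Y)$. Let $0<\theta\le1$, and suppose that at each shaded point the two-long-axis planes of the incident labels have angular diameter at most $C_{\rm d}\theta$, while every incident subcollection of at least $2m/A_{\rm ang}$ labels has angular diameter greater than $\theta/B_{\rm ang}$. Finally assume $$\theta\rho\ge2B_{\rm ang}\alpha .$$ Then there is a labelled refinement $(\mathcal P',Y')$, i.e.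 $\mathcal P'\subset\mathcal P$ as labels and $Y'(P)\subset Y(P)$ measurable for $P\in\mathcal P'$, satisfying $$M(Y')\ge\alpha^{\omega_{\rm fill}(\alpha)}M(Y),\qquad\omega_{\rm fill}(\alpha)=\frac{\log(1/c_{\rm fill})}{\log(1/\alpha)}\to0,$$ and such that whenever $U(\mathcal P',Y')$ meets a ball $B_0$ of radius $\theta\rho$, $$\frac{|U(\mathcal P',Y')\cap C'B_0|}{|C'B_0|}\ge\alpha^{4\eta+\omega(\alpha)} .$$ Passing to a labelled subfamily cannot increase the labelled $\Delta_{\max}$.
   Context: All cardinalities, masses and multiplicities count labels. $|\cdot|$ is Lebesgue measure in $\mathbb R^3$; $U(\mathcal P,Y)=\bigcup Y(P)$, $M(Y)=\sum|Y(P)|$, $\lambda(\mathcal P,Y)=M(Y)/\sum|P|$, $\mu(\mathcal P,Y)=M(Y)/|U(\mathcal P,Y)|$; $\Delta_{\max}(\mathcal P)=\sup_K|K|^{-1}\sum_{P\subset K}|P|$ over convex $K$ of positive finite volume. $C'B_0$ is the concentric ball with radius multiplied by $C'$. A $C_{\rm box}$-comparable rectangular $\alpha\times\rho\times1$ plank is a labelled box $P=x_P+\{t_se_s+t_me_m+t_\ell e_\ell:|t_s|\le a_P/2,|t_m|\le b_P/2,|t_\ell|\le\ell_P/2\}$ with an ordered orthonormal frame $(e_s,e_m,e_\ell)$ (part of the label) and ordered side lengths $a_P\le b_P\le\ell_P$, where $C_{\rm box}^{-1}\alpha\le a_P\le C_{\rm box}\alpha$, $C_{\rm box}^{-1}\rho\le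 b_P\le C_{\rm box}\rho$, $C_{\rm box}^{-1}\le\ell_P\le C_{\rm box}$. Its two-long-axis plane is $\operatorname{span}\{e_m,e_\ell\}$. The angle between planes with unit normals $n,n'$ is $\min\{1,\arccos|\langle n,n'\rangle|\}$ and the angular diameter of a collection is the maximum pairwise angle. A label $P$ is incident to $x$ if $x\in Y(P)$; shaded points are points of $U(\mathcal P,Y)$. *)

theory Defs
  imports "HOL-Analysis.Analysis" "HOL-Library.Landau_Symbols"
begin

record plank =
  pl_center :: "real^3"
  pl_es :: "real^3"
  pl_em :: "real^3"
  pl_el :: "real^3"
  pl_a :: real
  pl_b :: real
  pl_l :: real

definition carrier_of :: "plank \<Rightarrow> (real^3) set" where
  "carrier_of P =
     {pl_center P + ts *\<^sub>R pl_es P + tm *\<^sub>R pl_em P + tl *\<^sub>R pl_el P | ts tm tl.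
        \<bar>ts\<bar> \<le> pl_a P / 2 \<and> \<bar>tm\<bar> \<le> pl_b P / 2 \<and> \<bar>tl\<bar> \<le> pl_l P / 2}"

definition orthonormal_frame :: "plank \<Rightarrow> bool" where
  "orthonormal_frame P \<longleftrightarrow>
     norm (pl_es P) = 1 \<and> norm (pl_em P) = 1 \<and> norm (pl_el P) = 1 \<and>
     pl_es P \<bullet> pl_em P = 0 \<and> pl_es P \<bullet> pl_el P = 0 \<and> pl_em P \<bullet> pl_el P = 0"

definition comparable_plank :: "real \<Rightarrow> real \<Rightarrow> real \<Rightarrow> plank \<Rightarrow> bool" where
  "comparable_plank C \<alpha> \<rho> P \<longleftrightarrow>
     orthonormal_frame P \<and> pl_a P \<le> pl_b P \<and> pl_b P \<le> pl_l P \<and>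
     inverse C * \<alpha> \<le> pl_a P \<and> pl_a P \<le> C * \<alpha> \<and>
     inverse C * \<rho> \<le> pl_b P \<and> pl_b P \<le> C * \<rho> \<and>
     inverse C \<le> pl_l P \<and> pl_l P \<le> C"

definition long_plane :: "plank \<Rightarrow> (real^3) set" where
  "long_plane P = span {pl_em P, pl_el P}"

definition unit_normal :: "(real^3) set \<Rightarrow> real^3 \<Rightarrow> bool" where
  "unit_normal V n \<longleftrightarrow> norm n = 1 \<and> (\<forall>v\<in>V. n \<bullet> v = 0)"

text \<open>A plane has exactly two unit normals, which differ by a sign, so the described value is
  unique whenever both arguments are planes through the origin.\<close>

definition plane_angle :: "(real^3) set \<Rightarrow> (real^3) set \<Rightarrow> real" where
  "plane_angle V W =
     (THE \<phi>. \<exists>n n'. unit_normal V n \<and> unit_normal W n' \<and> \<phi> = min 1 (arccos \<bar>n \<bullet> n'\<bar>))"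

lemma unit_normal_long_plane:
  assumes "orthonormal_frame P"
  shows "unit_normal (long_plane P) n \<longleftrightarrow> n = pl_es P \<or> n = - pl_es P"
proof
  let ?e = "pl_es P" and ?f = "pl_em P" and ?g = "pl_el P"
  have fr: "?e \<bullet> ?e = 1" "?f \<bullet> ?f = 1" "?g \<bullet> ?g = 1"
    "?e \<bullet> ?f = 0" "?e \<bullet> ?g = 0" "?f \<bullet> ?g = 0"
    using assms by (auto simp: orthonormal_frame_def norm_eq_1)
  have dist: "?e \<noteq> ?f" "?e \<noteq> ?g" "?f \<noteq> ?g" using fr by auto
  {
    assume n: "unit_normal (long_plane P) n"
    have nf: "n \<bullet> ?f = 0" "n \<bullet> ?g = 0" and nn: "n \<bullet> n = 1"
      using n by (auto simp: unit_normal_def long_plane_def span_base norm_eq_1)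
    have po: "pairwise orthogonal {?e, ?f, ?g}"
      using fr by (auto simp: pairwise_def orthogonal_def inner_commute)
    have "0 \<notin> {?e, ?f, ?g}" using fr by auto
    then have ind: "independent {?e, ?f, ?g}"
      using po pairwise_orthogonal_independent by blast
    have "card {?e, ?f, ?g} = DIM(real^3)" using dist by simp
    then have sp: "span {?e, ?f, ?g} = UNIV"
      using ind by (metis card_eq_dim dim_UNIV subset_UNIV top.extremum_uniqueI finite.intros)
    define w where "w = n - (n \<bullet> ?e) *\<^sub>R ?e"
    have "orthogonal w v" if "v \<in> {?e, ?f, ?g}" for v
      using that fr nf by (auto simp: w_def orthogonal_def inner_diff_left)
    then have "orthogonal w w"
      using orthogonal_to_span[of w "{?e, ?f, ?g}" w] sp by (auto simp: orthogonal_commute)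
    then have weq: "n = (n \<bullet> ?e) *\<^sub>R ?e" by (simp add: w_def orthogonal_def)
    then have "n \<bullet> n = (n \<bullet> ?e) * (n \<bullet> ?e)"
      by (metis inner_commute inner_scaleR_left)
    then have "(n \<bullet> ?e)\<^sup>2 = 1" using nn by (simp add: power2_eq_square)
    then have "n \<bullet> ?e = 1 \<or> n \<bullet> ?e = -1" by (simp add: power2_eq_1_iff)
    then show "n = ?e \<or> n = - ?e" using weq by (metis scaleR_minus1_left scaleR_one)
  }
  assume "n = ?e \<or> n = - ?e"
  moreover have "?e \<bullet> v = 0" if "v \<in> span {?f, ?g}" for v
    using orthogonal_to_span[OF that, of ?e] fr by (auto simp: orthogonal_def)
  ultimately show "unit_normal (long_plane P) n"
    using fr by (auto simp: unit_normal_def long_plane_def norm_eq_1)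
qed

lemma plane_angle_long_plane:
  assumes "orthonormal_frame P" "orthonormal_frame Q"
  shows "plane_angle (long_plane P) (long_plane Q) = min 1 (arccos \<bar>pl_es P \<bullet> pl_es Q\<bar>)"
  unfolding plane_angle_def unit_normal_long_plane[OF assms(1)] unit_normal_long_plane[OF assms(2)]
  by (rule the_equality) auto

text \<open>A finite labelled multiset is a finite set \<open>I\<close> of labels with a map \<open>P\<close> to planks, not
  assumed injective.  Labels are natural numbers rather than elements of a type variable, so that
  constants quantified before the family do not depend on the label type.\<close>

definition shaded_family ::
    "real \<Rightarrow> real \<Rightarrow> real \<Rightarrow> real^3 \<Rightarrow> nat set \<Rightarrow> (nat \<Rightarrow> plank) \<Rightarrow> (nat \<Rightarrow> (real^3) set) \<Rightarrow> bool" where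
  "shaded_family C \<alpha> \<rho> z I P Y \<longleftrightarrow>
     finite I \<and>
     (\<forall>i\<in>I. comparable_plank C \<alpha> \<rho> (P i) \<and> carrier_of (P i) \<subseteq> cball z 1 \<and>
            Y i \<in> sets lebesgue \<and> Y i \<subseteq> carrier_of (P i))"

definition labelled_refinement ::
    "nat set \<Rightarrow> (nat \<Rightarrow> (real^3) set) \<Rightarrow> nat set \<Rightarrow> (nat \<Rightarrow> (real^3) set) \<Rightarrow> bool" where
  "labelled_refinement I Y I' Y' \<longleftrightarrow>
     I' \<subseteq> I \<and> (\<forall>i\<in>I'. Y' i \<in> sets lebesgue \<and> Y' i \<subseteq> Y i)"

definition shaded_union :: "nat set \<Rightarrow> (nat \<Rightarrow> (real^3) set) \<Rightarrow> (real^3) set" where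
  "shaded_union I Y = (\<Union>i\<in>I. Y i)"

definition shaded_mass :: "nat set \<Rightarrow> (nat \<Rightarrow> (real^3) set) \<Rightarrow> real" where
  "shaded_mass I Y = (\<Sum>i\<in>I. measure lebesgue (Y i))"

definition shading_density :: "nat set \<Rightarrow> (nat \<Rightarrow> plank) \<Rightarrow> (nat \<Rightarrow> (real^3) set) \<Rightarrow> real" where
  "shading_density I P Y = shaded_mass I Y / (\<Sum>i\<in>I. measure lebesgue (carrier_of (P i)))"

definition shading_multiplicity :: "nat set \<Rightarrow> (nat \<Rightarrow> (real^3) set) \<Rightarrow> real" where
  "shading_multiplicity I Y = shaded_mass I Y / measure lebesgue (shaded_union I Y)"

definition incident :: "nat set \<Rightarrow> (nat \<Rightarrow> (real^3) set) \<Rightarrow> real^3 \<Rightarrow> nat set" where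
  "incident I Y x = {i\<in>I. x \<in> Y i}"

text \<open>Only meaningful for a finite nonempty set of labels.\<close>

definition angular_diameter :: "(nat \<Rightarrow> plank) \<Rightarrow> nat set \<Rightarrow> real" where
  "angular_diameter P S =
     Max {plane_angle (long_plane (P i)) (long_plane (P j)) | i j. i \<in> S \<and> j \<in> S}"

text \<open>Convex sets in \<open>real^3\<close> are Lebesgue measurable but need not be Borel, hence
  \<^const>\<open>lebesgue\<close> and not \<^const>\<open>lborel\<close>.\<close>

definition delta_max :: "nat set \<Rightarrow> (nat \<Rightarrow> plank) \<Rightarrow> ennreal" where
  "delta_max I P =
     (SUP K\<in>{K. convex K \<and> 0 < emeasure lebesgue K \<and> emeasure lebesgue K < \<infinity>}.
        (\<Sum>i\<in>{i\<in>I. carrier_of (P i) \<subseteq> K}. emeasure lebesgue (carrier_of (P i)))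
          / emeasure lebesgue K)"

definition omega_fill :: "real \<Rightarrow> real \<Rightarrow> real" where
  "omega_fill c \<alpha> = ln (1 / c) / ln (1 / \<alpha>)"

end

theory Submission
  imports Defs
begin

text \<open>
  Write \<open>r = \<theta> \<rho>\<close> and cut space into cubes of side \<open>r\<close>. The refinement keeps all labels and exactly
  those shaded points whose cube is filled by \<open>U(\<P>, Y)\<close> to a fraction more than
  \<open>\<tau> = \<sigma>\<^sup>2 / B_ang\<close>, with \<open>\<sigma>\<close> a small multiple of \<open>\<alpha>\<^sup>\<eta>\<close>. A ball of radius \<open>r\<close> that meets the
  refined shading meets a kept cube, which lies in the ball of radius \<open>4 r\<close>; this gives the filling,
  with the exponent \<open>2 \<eta> + o(1)\<close> (\<open>dense_part_fills_balls\<close>). It remains to see that at least a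
  quarter of the mass is kept, that is, that the set \<open>V\<close> of discarded points carries little of it.

  This is an \<open>L\<^sup>2\<close> argument of Cordoba's type in cells of dimensions \<open>r \<times> \<rho> \<times> \<rho>\<close>. A piece of length
  \<open>\<rho>\<close> of a plank is an \<open>\<alpha> \<times> \<rho> \<times> \<rho>\<close> slab, and the labels at a point have normals within \<open>O(\<theta>)\<close> of each
  other, so the piece meets boundedly many cells and the plank \<open>O(1 / \<rho>)\<close> (\<open>card_cells_of\<close>). Let \<open>T\<close> be the part of \<open>V\<close> in one cell
  and \<open>N\<close> the number of labels whose shading meets it.
  \<^item> At each point at least \<open>m\<^sup>2 / 2\<close> pairs of incident labels make an angle of order at least
    \<open>\<theta> / B_ang\<close>, and two such slabs meet in volume \<open>O(\<alpha>\<^sup>2 \<rho> B_ang / \<theta>)\<close> inside the cell. Hence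
    \<open>m\<^sup>2 |T| \<lesssim> N\<^sup>2 \<alpha>\<^sup>2 \<rho> B_ang / \<theta>\<close>.
  \<^item> The cubes of side \<open>r\<close> are sparse in \<open>V\<close>, so \<open>|T| \<lesssim> \<tau> \<theta> \<rho>\<^sup>3\<close> (\<open>cell_volume\<close>).

  The product of the two is \<open>(m |T|)\<^sup>2 \<lesssim> (\<sigma> \<alpha> \<rho>\<^sup>2 N)\<^sup>2\<close> (\<open>cell_multiplicity_bound\<close>). Taking roots and
  summing over the cells gives \<open>m |V| \<lesssim> \<sigma> \<alpha> \<rho> |\<P>|\<close> (\<open>sparse_part_small\<close>). By the lower bound on the
  shading density, \<open>\<alpha>\<^sup>\<eta> \<alpha> \<rho> |\<P>|\<close> is at most a constant times the mass, so a suitable \<open>\<sigma>\<close> makes the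
  discarded part as small as desired. The factor \<open>1 / B_ang\<close> and the constants are absorbed in
  \<open>\<alpha> powr \<omega> \<alpha>\<close>, since \<open>log B_ang\<close> is of smaller order than \<open>log (1 / \<alpha>)\<close>.
\<close>

section \<open>The chordal distance between planes\<close>

text \<open>
  The distance between the lines spanned by two unit normals, measured on the sphere modulo
  sign. It replaces the angle of the two planes, to which it is comparable: its triangle
  inequality is that of the norm, and reversing a normal does not change it.
\<close>

definition chord_dist :: "real^3 \<Rightarrow> real^3 \<Rightarrow> real" where
  "chord_dist n n' = min (norm (n - n')) (norm (n + n'))"

lemma chord_dist_commute: "chord_dist a b = chord_dist b a"
  by (simp add: chord_dist_def norm_minus_commute add.commute)

lemma chord_dist_self [simp]: "chord_dist a a = 0"
  by (simp add: chord_dist_def)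

lemma chord_dist_triangle: "chord_dist a c \<le> chord_dist a b + chord_dist b c"
proof -
  have "norm (a - c) \<le> norm (a - b) + norm (b - c)" "norm (a - c) \<le> norm (a + b) + norm (b + c)"
    using norm_triangle_ineq[of "a - b" "b - c"] norm_triangle_ineq4[of "a + b" "b + c"] by simp_all
  moreover have "norm (a + c) \<le> norm (a - b) + norm (b + c)" "norm (a + c) \<le> norm (a + b) + norm (b - c)"
    using norm_triangle_ineq[of "a - b" "b + c"] norm_triangle_ineq4[of "a + b" "b - c"] by simp_all
  ultimately show ?thesis unfolding chord_dist_def by linarith
qed

lemma chord_dist_sq:
  assumes "norm n = 1" "norm n' = 1"
  shows "(chord_dist n n')\<^sup>2 = 2 - 2 * \<bar>n \<bullet> n'\<bar>"
proof -
  have e: "(norm (n - n'))\<^sup>2 = 2 - 2 * (n \<bullet> n')" "(norm (n + n'))\<^sup>2 = 2 + 2 * (n \<bullet> n')"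
    using assms by (auto simp: power2_norm_eq_inner inner_diff inner_add inner_commute norm_eq_1)
  have "norm (n - n') \<le> norm (n + n') \<longleftrightarrow> 0 \<le> n \<bullet> n'"
    using e by (smt (verit) norm_ge_zero power2_le_imp_le power_mono)
  then show ?thesis using e by (auto simp: chord_dist_def min_def)
qed

lemma abs_inner_unit_le:
  assumes "norm n = 1" "norm n' = 1" shows "\<bar>n \<bullet> n'\<bar> \<le> 1"
  using Cauchy_Schwarz_ineq2[of n n'] assms by simp

lemma chord_dist_le_arccos:
  assumes "norm n = 1" "norm n' = 1"
  shows "chord_dist n n' \<le> arccos \<bar>n \<bullet> n'\<bar>"
proof -
  let ?t = "\<bar>n \<bullet> n'\<bar>" and ?p = "arccos \<bar>n \<bullet> n'\<bar>"
  have t: "0 \<le> ?t" "?t \<le> 1" using abs_inner_unit_le[OF assms] by auto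
  have p: "0 \<le> ?p" using arccos_lbound[of ?t] t by auto
  have "?t = cos (2 * (?p / 2))" using t by simp
  also have "\<dots> = 1 - 2 * (sin (?p/2))\<^sup>2" by (rule cos_double_sin)
  finally have "(chord_dist n n')\<^sup>2 = (2 * sin (?p/2))\<^sup>2"
    unfolding chord_dist_sq[OF assms] by (simp add: power_mult_distrib)
  also have "\<dots> \<le> ?p\<^sup>2"
    using abs_sin_x_le_abs_x[of "?p/2"] p by (intro abs_le_square_iff[THEN iffD1]) auto
  finally show ?thesis using p by (rule power2_le_imp_le)
qed

text \<open>
  The angle is at most a right angle, so its half \<open>q\<close> lies in the range where \<open>q \<le> tan q\<close> and
  \<open>cos q \<ge> 1/2\<close>, while the chord is \<open>2 sin q\<close>.
\<close>

lemma arccos_le_chord_dist: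
  assumes "norm n = 1" "norm n' = 1"
  shows "arccos \<bar>n \<bullet> n'\<bar> \<le> 2 * chord_dist n n'"
proof -
  define q where "q = arccos \<bar>n \<bullet> n'\<bar> / 2"
  have t: "0 \<le> \<bar>n \<bullet> n'\<bar>" "\<bar>n \<bullet> n'\<bar> \<le> 1" using abs_inner_unit_le[OF assms] by auto
  have q: "0 \<le> q" "q \<le> pi / 4"
    using arccos_lbound[of "\<bar>n \<bullet> n'\<bar>"] arccos_le_pi2[of "\<bar>n \<bullet> n'\<bar>"] t by (auto simp: q_def)
  have "\<bar>n \<bullet> n'\<bar> = cos (2 * q)" using t by (simp add: q_def)
  then have "(chord_dist n n')\<^sup>2 = (2 * sin q)\<^sup>2"
    unfolding chord_dist_sq[OF assms] cos_double_sin by (simp add: power_mult_distrib)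
  moreover have "0 \<le> sin q" using q pi_gt_zero by (intro sin_ge_zero) linarith+
  moreover have "0 \<le> chord_dist n n'" by (simp add: chord_dist_def)
  ultimately have ps: "chord_dist n n' = 2 * sin q"
    using power2_eq_imp_eq[of "chord_dist n n'" "2 * sin q"] by linarith
  have c: "1 / 2 \<le> cos q"
    using q pi_gt_zero cos_60 cos_mono_le_eq[of "pi/3" q] by linarith
  have "0 \<le> tan q" using q pi_gt_zero by (intro tan_pos_pi2_le) linarith+
  moreover have "arctan (tan q) = q" using q pi_gt_zero by (intro arctan_tan) linarith+
  ultimately have "q \<le> sin q / cos q" using arctan_le_self[of "tan q"] by (simp add: tan_def)
  then have "q * cos q \<le> sin q" using c by (simp add: pos_le_divide_eq)
  moreover have "q * (1 / 2) \<le> q * cos q"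
    using c q by (intro mult_left_mono) auto
  ultimately show ?thesis using ps unfolding q_def by simp
qed

text \<open>
  This is where transversality enters: two slabs of thickness \<open>s\<close> meet in a bar of cross section
  \<open>s\<^sup>2\<close> over the sine of their angle, and the sine is the norm of the cross product of the
  normals.
\<close>

lemma cross_norm_ge:
  assumes "norm n = 1" "norm n' = 1"
  shows "chord_dist n n' / 2 \<le> norm (cross3 n n')"
proof -
  have t: "0 \<le> \<bar>n \<bullet> n'\<bar>" "\<bar>n \<bullet> n'\<bar> \<le> 1" using abs_inner_unit_le[OF assms] by auto
  have "(norm (cross3 n n'))\<^sup>2 = 1 - \<bar>n \<bullet> n'\<bar>\<^sup>2"
    using norm_cross_dot[of n n'] assms by simp
  moreover have "\<bar>n \<bullet> n'\<bar>\<^sup>2 \<le> \<bar>n \<bullet> n'\<bar>"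
    unfolding power2_eq_square using t by (intro mult_left_le_one_le) auto
  ultimately have "(chord_dist n n' / 2)\<^sup>2 \<le> (norm (cross3 n n'))\<^sup>2"
    using t unfolding power_divide chord_dist_sq[OF assms] by simp
  then show ?thesis by (rule power2_le_imp_le) simp
qed

section \<open>Volumes of slabs\<close>

text \<open>
  The linear map with rows \<open>u, v, w\<close> sends the set onto an axis-parallel box, and its
  determinant is the triple product. All volumes below come from this one: planks,
  neighbourhoods of planes, and intersections of two slabs.
\<close>

lemma parallelepiped:
  fixes u v w :: "real^3" and c1 c2 c3 :: real
  assumes D: "u \<bullet> cross3 v w \<noteq> 0" and d: "0 \<le> d1" "0 \<le> d2" "0 \<le> d3"
  defines "S \<equiv> {x. \<bar>x \<bullet> u - c1\<bar> \<le> d1 \<and> \<bar>x \<bullet> v - c2\<bar> \<le> d2 \<and> \<bar>x \<bullet> w - c3\<bar> \<le> d3}"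
  shows "S \<in> lmeasurable"
    and "measure lebesgue S = 8 * d1 * d2 * d3 / \<bar>u \<bullet> cross3 v w\<bar>"
proof -
  define A :: "real^3^3" where "A = vector [u, v, w]"
  have detA: "det A = u \<bullet> cross3 v w" by (simp add: A_def dot_cross_det)
  then obtain A' where A': "A ** A' = mat 1" "A' ** A = mat 1"
    using D invertible_det_nz[of A] by (auto simp: invertible_def)
  have comp: "(A *v x) $ 1 = x \<bullet> u" "(A *v x) $ 2 = x \<bullet> v" "(A *v x) $ 3 = x \<bullet> w" for x
    by (simp_all add: A_def matrix_vector_mult_def inner_vec_def sum_3 mult.commute)
  define a :: "real^3" where "a = vector [c1 - d1, c2 - d2, c3 - d3]"
  define b :: "real^3" where "b = vector [c1 + d1, c2 + d2, c3 + d3]"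
  have inS: "x \<in> S \<longleftrightarrow> A *v x \<in> cbox a b" for x
    by (auto simp: S_def mem_box_cart forall_3 comp a_def b_def abs_le_iff algebra_simps)
  have fS: "(*v) A ` S = cbox a b"
  proof
    show "cbox a b \<subseteq> (*v) A ` S"
    proof
      fix y assume "y \<in> cbox a b"
      moreover have "A *v (A' *v y) = y" using A' by (simp add: matrix_vector_mul_assoc)
      ultimately show "y \<in> (*v) A ` S" using inS by (metis image_eqI)
    qed
  qed (auto simp: inS)
  have gS: "S = (*v) A' ` cbox a b"
  proof -
    have "A' *v (A *v x) = x" for x using A' by (simp add: matrix_vector_mul_assoc)
    then show ?thesis unfolding fS[symmetric] by (auto simp: image_image)
  qed
  show S: "S \<in> lmeasurable" unfolding gS
    by (intro measurable_linear_image) auto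
  have ne: "cbox a b \<noteq> {}"
    using d by (auto simp: interval_ne_empty_cart forall_3 a_def b_def)
  have "measure lebesgue (cbox a b) = \<bar>det A\<bar> * measure lebesgue S"
    using measure_linear_image[of "(*v) A" S] S unfolding fS by simp
  moreover have "measure lebesgue (cbox a b) = 8 * d1 * d2 * d3"
  proof -
    have "(\<Prod>i\<in>UNIV. f i) = f 1 * f 2 * f 3" for f :: "3 \<Rightarrow> real"
      unfolding UNIV_3 by simp
    then show ?thesis using ne by (simp add: content_cbox_cart a_def b_def)
  qed
  ultimately show "measure lebesgue S = 8 * d1 * d2 * d3 / \<bar>u \<bullet> cross3 v w\<bar>"
    using D unfolding detA by (simp add: field_simps)
qed

lemma slab_volume:
  fixes n :: "real^3"
  assumes "norm n = 1" "0 \<le> s" "0 \<le> R" "S \<in> sets lebesgue"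
    and "\<And>x. x \<in> S \<Longrightarrow> \<bar>(x - x0) \<bullet> n\<bar> \<le> s \<and> norm (x - x0) \<le> R"
  shows "measure lebesgue S \<le> 8 * s * R\<^sup>2"
proof -
  have "n \<noteq> 0" using assms(1) by auto
  then obtain u :: "real^3" where u0: "u \<noteq> 0" "orthogonal n u"
  proof -
    obtain k :: 3 where "cross3 n (axis k 1) \<noteq> 0" using cross_basis_nonzero[OF \<open>n \<noteq> 0\<close>] by blast
    moreover have "orthogonal n (cross3 n (axis k 1))"
      by (simp add: orthogonal_def dot_cross_self)
    ultimately show ?thesis using that by blast
  qed
  define v where "v = u /\<^sub>R norm u"
  have v: "norm v = 1" "n \<bullet> v = 0" using u0 by (auto simp: v_def orthogonal_def)
  define w where "w = cross3 n v"
  have w: "norm w = 1" using norm_cross_dot[of n v] v assms by (simp add: w_def norm_eq_1 power2_norm_eq_inner)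
  have "cross3 v w = (v \<bullet> v) *\<^sub>R n - (v \<bullet> n) *\<^sub>R v"
    unfolding w_def by (simp add: Lagrange)
  then have "cross3 v w = n" using v by (simp add: inner_commute norm_eq_1)
  then have D: "n \<bullet> cross3 v w = 1" using assms by (simp add: norm_eq_1)
  let ?T = "{x. \<bar>x \<bullet> n - x0 \<bullet> n\<bar> \<le> s \<and> \<bar>x \<bullet> v - x0 \<bullet> v\<bar> \<le> R \<and> \<bar>x \<bullet> w - x0 \<bullet> w\<bar> \<le> R}"
  have "S \<subseteq> ?T"
  proof
    fix x assume "x \<in> S"
    then have "\<bar>(x - x0) \<bullet> n\<bar> \<le> s" "norm (x - x0) \<le> R" using assms by auto
    moreover have "\<bar>(x - x0) \<bullet> v\<bar> \<le> norm (x - x0)" "\<bar>(x - x0) \<bullet> w\<bar> \<le> norm (x - x0)"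
      using Cauchy_Schwarz_ineq2[of "x - x0" v] Cauchy_Schwarz_ineq2[of "x - x0" w] v w by auto
    ultimately show "x \<in> ?T" by (simp add: inner_diff_left)
  qed
  then have "measure lebesgue S \<le> measure lebesgue ?T"
    using parallelepiped(1)[of n v w s R R] D assms by (intro measure_mono_fmeasurable) auto
  also have "\<dots> = 8 * s * R\<^sup>2"
    using parallelepiped(2)[of n v w s R R] D assms by (simp add: power2_eq_square)
  finally show ?thesis .
qed

text \<open>
  The third direction, along which only the ball of radius \<open>R\<close> confines the set, is the
  normalised cross product of the normals; for it the triple product equals the norm of that
  cross product.
\<close>

lemma two_slabs_volume:
  fixes n n' :: "real^3"
  assumes "norm n = 1" "norm n' = 1" "0 < \<kappa>" "\<kappa> \<le> chord_dist n n'" "0 \<le> s" "0 \<le> R"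
    and "S \<in> sets lebesgue"
    and "\<And>x. x \<in> S \<Longrightarrow> \<bar>(x - c) \<bullet> n\<bar> \<le> s \<and> \<bar>(x - c') \<bullet> n'\<bar> \<le> s \<and> norm (x - x0) \<le> R"
  shows "measure lebesgue S \<le> 16 * s\<^sup>2 * R / \<kappa>"
proof -
  have nz: "\<kappa> / 2 \<le> norm (cross3 n n')" using cross_norm_ge[of n n'] assms by simp
  define w where "w = cross3 n n' /\<^sub>R norm (cross3 n n')"
  have pos: "0 < norm (cross3 n n')" using nz assms by linarith
  have w: "norm w = 1" using pos by (simp add: w_def)
  have D: "n \<bullet> cross3 n' w = norm (cross3 n n')"
  proof -
    have "n \<bullet> cross3 n' w = cross3 n n' \<bullet> w"
      by (simp add: cross3_simps)
    also have "\<dots> = norm (cross3 n n')"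
      using pos by (simp add: w_def dot_square_norm power2_eq_square)
    finally show ?thesis .
  qed
  let ?T = "{x. \<bar>x \<bullet> n - c \<bullet> n\<bar> \<le> s \<and> \<bar>x \<bullet> n' - c' \<bullet> n'\<bar> \<le> s \<and> \<bar>x \<bullet> w - x0 \<bullet> w\<bar> \<le> R}"
  have "S \<subseteq> ?T"
  proof
    fix x assume "x \<in> S"
    then have "\<bar>(x - c) \<bullet> n\<bar> \<le> s" "\<bar>(x - c') \<bullet> n'\<bar> \<le> s" "norm (x - x0) \<le> R" using assms by auto
    moreover have "\<bar>(x - x0) \<bullet> w\<bar> \<le> norm (x - x0)"
      using Cauchy_Schwarz_ineq2[of "x - x0" w] w by auto
    ultimately show "x \<in> ?T" by (simp add: inner_diff_left)
  qed
  then have "measure lebesgue S \<le> measure lebesgue ?T"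
    using parallelepiped(1)[of n n' w s s R] D pos assms by (intro measure_mono_fmeasurable) auto
  also have "\<dots> = 8 * s\<^sup>2 * R / norm (cross3 n n')"
    using parallelepiped(2)[of n n' w s s R] D pos assms by (simp add: power2_eq_square)
  also have "\<dots> \<le> 8 * s\<^sup>2 * R / (\<kappa> / 2)"
    using nz assms pos by (intro divide_left_mono) auto
  finally show ?thesis by simp
qed

section \<open>Grids\<close>

definition grid :: "real \<Rightarrow> real^3 \<Rightarrow> int^3" where
  "grid s x = (\<chi> i. \<lfloor>x $ i / s\<rfloor>)"

definition cube :: "real \<Rightarrow> int^3 \<Rightarrow> (real^3) set" where
  "cube s v = {x. grid s x = v}"

lemma norm_le_three:
  fixes x :: "real^3"
  assumes "\<And>i. \<bar>x $ i\<bar> \<le> s"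
  shows "norm x \<le> 3 * s"
proof -
  have "norm x \<le> (\<Sum>i\<in>UNIV. \<bar>x $ i\<bar>)" by (rule norm_le_l1_cart)
  also have "\<dots> \<le> (\<Sum>i\<in>(UNIV :: 3 set). s)" using assms by (intro sum_mono) auto
  finally show ?thesis by simp
qed

lemma floor_eq_imp_close:
  fixes a b s :: real
  assumes "\<lfloor>a / s\<rfloor> = \<lfloor>b / s\<rfloor>" "0 < s"
  shows "\<bar>a - b\<bar> \<le> s"
proof -
  have "\<bar>a / s - b / s\<bar> \<le> 1" using assms(1) by linarith
  then have "\<bar>(a - b) / s\<bar> \<le> 1" by (simp add: diff_divide_distrib)
  then show ?thesis using assms(2) by (simp add: abs_divide)
qed

lemma floor_close:
  fixes a b s :: real
  assumes "\<bar>a - b\<bar> \<le> D" "0 < s"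
  shows "\<bar>real_of_int \<lfloor>a / s\<rfloor> - real_of_int \<lfloor>b / s\<rfloor>\<bar> \<le> D / s + 1"
proof -
  have "\<bar>a / s - b / s\<bar> = \<bar>a - b\<bar> / s" using assms(2) by (simp add: diff_divide_distrib[symmetric])
  also have "\<dots> \<le> D / s" using assms by (intro divide_right_mono) auto
  finally show ?thesis by linarith
qed

lemma grid_eq_imp_close:
  assumes "grid s x = grid s y" "0 < s"
  shows "norm (x - y) \<le> 3 * s"
  using assms by (intro norm_le_three) (auto simp: grid_def vec_eq_iff intro!: floor_eq_imp_close)

lemma grid_close:
  assumes "norm (x - y) \<le> D" "0 < s"
  shows "\<bar>real_of_int (grid s x $ i) - real_of_int (grid s y $ i)\<bar> \<le> D / s + 1"
proof -
  have "\<bar>x $ i - y $ i\<bar> \<le> D"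
    using component_le_norm_cart[of "x - y" i] assms(1) by simp
  then show ?thesis using floor_close[OF _ assms(2)] by (simp add: grid_def)
qed

lemma card_close_ints:
  fixes W :: "int set"
  assumes "\<And>v w. v \<in> W \<Longrightarrow> w \<in> W \<Longrightarrow> \<bar>real_of_int v - real_of_int w\<bar> \<le> k" and "0 \<le> k"
  shows "finite W \<and> real (card W) \<le> 2 * k + 1"
proof (cases "W = {}")
  case False
  then obtain v where v: "v \<in> W" by auto
  let ?B = "{v - \<lfloor>k\<rfloor>..v + \<lfloor>k\<rfloor>}"
  have sub: "W \<subseteq> ?B"
  proof
    fix w assume "w \<in> W"
    then have "real_of_int \<bar>v - w\<bar> \<le> k" using assms(1)[OF v] by simp
    then have "\<bar>v - w\<bar> \<le> \<lfloor>k\<rfloor>" by (simp add: le_floor_iff)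
    then show "w \<in> ?B" by auto
  qed
  then have "finite W" using finite_subset by blast
  moreover have "card W \<le> card ?B" using sub by (intro card_mono) auto
  then have "real (card W) \<le> real (nat (2 * \<lfloor>k\<rfloor> + 1))" by simp
  moreover have "0 \<le> \<lfloor>k\<rfloor>" using assms(2) by simp
  then have "real (nat (2 * \<lfloor>k\<rfloor> + 1)) \<le> 2 * k + 1" by simp
  ultimately show ?thesis by linarith
qed (use assms(2) in auto)

lemma card_close_vecs:
  fixes W :: "(int^3) set"
  assumes "\<And>v w i. v \<in> W \<Longrightarrow> w \<in> W \<Longrightarrow> \<bar>real_of_int (v $ i) - real_of_int (w $ i)\<bar> \<le> k" and "0 \<le> k"
  shows "finite W \<and> real (card W) \<le> (2 * k + 1)^3"
proof -
  let ?p = "\<lambda>i. (\<lambda>v. v $ i) ` W"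
  have 1: "finite (?p i) \<and> real (card (?p i)) \<le> 2 * k + 1" for i
    using assms by (intro card_close_ints) auto
  let ?f = "\<lambda>v :: int^3. (v $ 1, v $ 2, v $ 3)"
  have inj: "inj_on ?f W" by (auto simp: inj_on_def vec_eq_iff forall_3)
  have sub: "?f ` W \<subseteq> ?p 1 \<times> ?p 2 \<times> ?p 3" by auto
  have fin: "finite (?p 1 \<times> ?p 2 \<times> ?p 3)" using 1 by auto
  have "finite W" using inj sub fin by (meson finite_imageD finite_subset)
  moreover have "card W = card (?f ` W)" using inj by (simp add: card_image)
  moreover have "\<dots> \<le> card (?p 1 \<times> ?p 2 \<times> ?p 3)" using sub fin by (rule card_mono[rotated])
  ultimately have "real (card W) \<le> real (card (?p 1)) * (real (card (?p 2)) * real (card (?p 3)))"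
    by (simp add: card_cartesian_product flip: of_nat_mult)
  also have "\<dots> \<le> (2 * k + 1) * ((2 * k + 1) * (2 * k + 1))"
    using 1 assms(2) by (intro mult_mono) auto
  finally show ?thesis using \<open>finite W\<close> by (simp add: power3_eq_cube)
qed

lemma finite_grid_image:
  assumes "bounded S" "0 < s"
  shows "finite (grid s ` S)"
proof -
  obtain D where D: "\<And>x y. x \<in> S \<Longrightarrow> y \<in> S \<Longrightarrow> norm (x - y) \<le> D"
    using bounded_two_points[of S] assms(1) by (auto simp: dist_norm)
  have "finite (grid s ` S) \<and> real (card (grid s ` S)) \<le> (2 * (\<bar>D\<bar> / s + 1) + 1)^3"
  proof (rule card_close_vecs)
    fix v w i assume "v \<in> grid s ` S" "w \<in> grid s ` S"
    then obtain x y where "x \<in> S" "y \<in> S" "v = grid s x" "w = grid s y" by auto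
    moreover have "norm (x - y) \<le> \<bar>D\<bar>" using D[OF \<open>x \<in> S\<close> \<open>y \<in> S\<close>] by simp
    ultimately show "\<bar>real_of_int (v $ i) - real_of_int (w $ i)\<bar> \<le> \<bar>D\<bar> / s + 1"
      using grid_close[OF _ assms(2)] by simp
  qed (use assms(2) in auto)
  then show ?thesis ..
qed

lemma floor_preimage_borel:
  assumes "continuous_on UNIV (f :: real^3 \<Rightarrow> real)"
  shows "{x. \<lfloor>f x\<rfloor> = h} \<in> sets borel"
proof -
  have [measurable]: "f \<in> borel_measurable borel" using assms by (rule borel_measurable_continuous_onI)
  have "{x. \<lfloor>f x\<rfloor> = h} = {x \<in> space borel. real_of_int h \<le> f x \<and> f x < real_of_int h + 1}"
    by (auto simp: floor_eq_iff)
  also have "\<dots> \<in> sets borel" by measurable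
  finally show ?thesis .
qed

lemma cube_borel: "cube s v \<in> sets borel"
proof -
  have "cube s v = (\<Inter>i. {x. \<lfloor>x $ i / s\<rfloor> = v $ i})"
    by (auto simp: cube_def grid_def vec_eq_iff)
  also have "\<dots> \<in> sets borel"
    by (intro sets.countable_INT'') (auto intro!: floor_preimage_borel continuous_intros)
  finally show ?thesis .
qed

lemma cube_bounded:
  assumes "0 < s" shows "bounded (cube s v)"
proof (cases "cube s v = {}")
  case False
  then obtain y where "y \<in> cube s v" by auto
  then have "cube s v \<subseteq> cball y (3 * s)"
    using grid_eq_imp_close[OF _ assms] by (auto simp: cube_def dist_norm)
  then show ?thesis using bounded_cball bounded_subset by blast
qed auto

lemma cube_lmeasurable: "0 < s \<Longrightarrow> cube s v \<in> lmeasurable"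
  using cube_bounded cube_borel by (intro bounded_set_imp_lmeasurable) auto

lemma cube_volume_ge:
  assumes "0 < s" shows "s^3 \<le> measure lebesgue (cube s v)"
proof -
  define a b :: "real^3" where "a = (\<chi> i. s * v $ i)" and "b = (\<chi> i. s * (v $ i + 1))"
  have "box a b \<subseteq> cube s v"
    using assms by (auto simp: mem_box_cart a_def b_def cube_def grid_def vec_eq_iff floor_eq_iff field_simps less_imp_le)
  then have "measure lebesgue (box a b) \<le> measure lebesgue (cube s v)"
    using cube_lmeasurable[OF assms] by (intro measure_mono_fmeasurable) auto
  moreover have "cbox a b \<noteq> {}" using assms by (auto simp: interval_ne_empty_cart a_def b_def)
  then have "measure lebesgue (cbox a b) = s^3"
    by (simp add: content_cbox_cart a_def b_def algebra_simps power3_eq_cube)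
  ultimately show ?thesis by (simp add: measure_lborel_box_eq measure_lborel_cbox_eq)
qed

section \<open>Double counting\<close>

lemma integrable_indicator_lmeasurable:
  "A \<in> lmeasurable \<Longrightarrow> integrable lebesgue (indicator A :: _ \<Rightarrow> real)"
  by (intro integrable_real_indicator fmeasurableD) (auto simp: fmeasurable_def simp del: emeasure_completion)

lemma sum_measure_eq_integral:
  assumes "finite R" "A \<in> lmeasurable" "\<And>r. r \<in> R \<Longrightarrow> E r \<in> sets lebesgue"
  shows "integrable lebesgue (\<lambda>x. indicator A x * real (card {r\<in>R. x \<in> E r}))"
    and "(\<Sum>r\<in>R. measure lebesgue (A \<inter> E r)) = (\<integral>x. indicator A x * real (card {r\<in>R. x \<in> E r}) \<partial>lebesgue)"
proof -
  have eq: "(\<lambda>x. indicator A x * real (card {r\<in>R. x \<in> E r})) = (\<lambda>x. \<Sum>r\<in>R. indicator (A \<inter> E r) x)"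
  proof
    fix x
    have "(\<Sum>r\<in>R. indicator (A \<inter> E r) x) = indicator A x * (\<Sum>r\<in>R. indicator (E r) x :: real)"
      by (simp add: sum_distrib_left indicator_inter_arith)
    also have "(\<Sum>r\<in>R. indicator (E r) x :: real) = (\<Sum>r\<in>R. if x \<in> E r then 1 else 0)"
      by (intro sum.cong) (auto simp: indicator_def)
    also have "\<dots> = real (card {r\<in>R. x \<in> E r})"
      using assms(1) by (simp add: sum.If_cases Int_def)
    finally show "indicator A x * real (card {r\<in>R. x \<in> E r}) = (\<Sum>r\<in>R. indicator (A \<inter> E r) x)" by simp
  qed
  have m: "A \<inter> E r \<in> lmeasurable" if "r \<in> R" for r
    using assms that by (intro fmeasurable_Int_fmeasurable) auto
  have i: "integrable lebesgue (indicator (A \<inter> E r) :: _ \<Rightarrow> real)" if "r \<in> R" for r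
    using m that by (intro integrable_indicator_lmeasurable)
  show "integrable lebesgue (\<lambda>x. indicator A x * real (card {r\<in>R. x \<in> E r}))"
    unfolding eq using i by (intro Bochner_Integration.integrable_sum) auto
  show "(\<Sum>r\<in>R. measure lebesgue (A \<inter> E r)) = (\<integral>x. indicator A x * real (card {r\<in>R. x \<in> E r}) \<partial>lebesgue)"
    unfolding eq using i by (subst Bochner_Integration.integral_sum) auto
qed

text \<open>
  Both counting inequalities integrate the number of sets \<open>E r\<close> through a point of \<open>A\<close>. The
  lower one is used for shadings and, with \<open>R\<close> a set of pairs of labels, for intersections of
  shadings.
\<close>

lemma double_count_ge:
  assumes "finite R" "A \<in> lmeasurable" "\<And>r. r \<in> R \<Longrightarrow> E r \<in> sets lebesgue"
    and "\<And>x. x \<in> A \<Longrightarrow> \<kappa> \<le> real (card {r\<in>R. x \<in> E r})"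
  shows "\<kappa> * measure lebesgue A \<le> (\<Sum>r\<in>R. measure lebesgue (A \<inter> E r))"
proof -
  have iA: "integrable lebesgue (indicator A :: _ \<Rightarrow> real)"
    using assms(2) by (rule integrable_indicator_lmeasurable)
  have "\<kappa> * measure lebesgue A = (\<integral>x. indicator A x * \<kappa> \<partial>lebesgue)"
    using iA by simp
  also have "\<dots> \<le> (\<integral>x. indicator A x * real (card {r\<in>R. x \<in> E r}) \<partial>lebesgue)"
  proof (rule integral_mono)
    show "integrable lebesgue (\<lambda>x. indicator A x * \<kappa>)" using iA by (intro integrable_mult_left) auto
    show "integrable lebesgue (\<lambda>x. indicator A x * real (card {r\<in>R. x \<in> E r}))"
      by (rule sum_measure_eq_integral(1)[where E = E, OF assms(1-3)])
  qed (use assms(4) in \<open>auto simp: indicator_def\<close>)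
  finally show ?thesis using sum_measure_eq_integral(2)[where E = E, OF assms(1-3)] by simp
qed

lemma double_count_le:
  assumes "finite R" "A \<in> lmeasurable" "\<And>r. r \<in> R \<Longrightarrow> E r \<in> sets lebesgue"
    and "\<And>x. x \<in> A \<Longrightarrow> real (card {r\<in>R. x \<in> E r}) \<le> \<kappa>"
  shows "(\<Sum>r\<in>R. measure lebesgue (A \<inter> E r)) \<le> \<kappa> * measure lebesgue A"
proof -
  have iA: "integrable lebesgue (indicator A :: _ \<Rightarrow> real)"
    using assms(2) by (rule integrable_indicator_lmeasurable)
  have "(\<integral>x. indicator A x * real (card {r\<in>R. x \<in> E r}) \<partial>lebesgue) \<le> (\<integral>x. indicator A x * \<kappa> \<partial>lebesgue)"
  proof (rule integral_mono)
    show "integrable lebesgue (\<lambda>x. indicator A x * \<kappa>)" using iA by (intro integrable_mult_left) auto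
    show "integrable lebesgue (\<lambda>x. indicator A x * real (card {r\<in>R. x \<in> E r}))"
      by (rule sum_measure_eq_integral(1)[where E = E, OF assms(1-3)])
  qed (use assms(4) in \<open>auto simp: indicator_def\<close>)
  also have "\<dots> = \<kappa> * measure lebesgue A" using iA by simp
  finally show ?thesis using sum_measure_eq_integral(2)[where E = E, OF assms(1-3)] by simp
qed

text \<open>
  A set whose grid cubes are all sparsely filled by \<open>V\<close> has measure at most \<open>\<tau>\<close> times the volume
  of the cubes that it meets, as the cubes are disjoint. The occupied cubes need not be counted:
  their union is estimated later by a slab containing it.
\<close>

lemma sparse_subset_volume:
  assumes "0 < s" "V \<in> sets lebesgue" "bounded T" "T \<subseteq> V" "T \<in> sets lebesgue"
    and sparse: "\<And>x. x \<in> T \<Longrightarrow> measure lebesgue (V \<inter> cube s (grid s x)) \<le> \<tau> * measure lebesgue (cube s (grid s x))"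
  shows "measure lebesgue T \<le> \<tau> * measure lebesgue (\<Union>v\<in>grid s ` T. cube s v)"
proof -
  let ?G = "grid s ` T"
  have fin: "finite ?G" using assms by (intro finite_grid_image)
  have VI: "V \<inter> cube s v \<in> lmeasurable" for v
    using cube_lmeasurable[OF assms(1)] assms(2) by (metis Int_commute fmeasurable_Int_fmeasurable)
  have "T \<subseteq> (\<Union>v\<in>?G. V \<inter> cube s v)" using assms(4) by (auto simp: cube_def)
  then have "measure lebesgue T \<le> measure lebesgue (\<Union>v\<in>?G. V \<inter> cube s v)"
    using fin VI assms(5) by (intro measure_mono_fmeasurable fmeasurable.finite_UN) auto
  also have "\<dots> \<le> (\<Sum>v\<in>?G. measure lebesgue (V \<inter> cube s v))"
    using fin VI by (intro measure_UNION_le) auto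
  also have "\<dots> \<le> (\<Sum>v\<in>?G. \<tau> * measure lebesgue (cube s v))"
    using sparse by (intro sum_mono) auto
  also have "\<dots> = \<tau> * measure lebesgue (\<Union>v\<in>?G. cube s v)"
  proof -
    have "disjoint_family_on (cube s) ?G" by (auto simp: disjoint_family_on_def cube_def)
    then have "measure lebesgue (\<Union>v\<in>?G. cube s v) = (\<Sum>v\<in>?G. measure lebesgue (cube s v))"
      using fin cube_lmeasurable[OF assms(1)] 
      by (intro measure_finite_Union) (auto dest: fmeasurableD fmeasurableD2 simp del: emeasure_completion)
    then show ?thesis by (simp add: sum_distrib_left)
  qed
  finally show ?thesis .
qed

section \<open>Planks\<close>

lemma orthonormal_expansion:
  assumes "orthonormal_frame P"
  shows "y = (y \<bullet> pl_es P) *\<^sub>R pl_es P + (y \<bullet> pl_em P) *\<^sub>R pl_em P + (y \<bullet> pl_el P) *\<^sub>R pl_el P"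
proof -
  let ?e = "pl_es P" and ?f = "pl_em P" and ?g = "pl_el P"
  have fr: "?e \<bullet> ?e = 1" "?f \<bullet> ?f = 1" "?g \<bullet> ?g = 1"
    "?e \<bullet> ?f = 0" "?e \<bullet> ?g = 0" "?f \<bullet> ?g = 0" "?f \<bullet> ?e = 0" "?g \<bullet> ?e = 0" "?g \<bullet> ?f = 0"
    using assms by (auto simp: orthonormal_frame_def norm_eq_1 inner_commute)
  have po: "pairwise orthogonal {?e, ?f, ?g}"
    using fr by (auto simp: pairwise_def orthogonal_def)
  moreover have "0 \<notin> {?e, ?f, ?g}" using fr by auto
  ultimately have ind: "independent {?e, ?f, ?g}" using pairwise_orthogonal_independent by blast
  have "?e \<noteq> ?f" "?e \<noteq> ?g" "?f \<noteq> ?g" using fr by auto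
  then have "card {?e, ?f, ?g} = DIM(real^3)" by simp
  then have sp: "span {?e, ?f, ?g} = UNIV"
    using ind by (metis card_eq_dim dim_UNIV subset_UNIV top.extremum_uniqueI finite.intros)
  define w where "w = y - ((y \<bullet> ?e) *\<^sub>R ?e + (y \<bullet> ?f) *\<^sub>R ?f + (y \<bullet> ?g) *\<^sub>R ?g)"
  have "orthogonal w v" if "v \<in> {?e, ?f, ?g}" for v
    using that fr by (auto simp: w_def orthogonal_def inner_diff_left inner_add_left)
  then have "orthogonal w w"
    using orthogonal_to_span[of w "{?e, ?f, ?g}" w] sp by (auto simp: orthogonal_commute)
  then show ?thesis by (simp add: w_def orthogonal_def)
qed

lemma carrier_iff:
  assumes "orthonormal_frame P"
  shows "x \<in> carrier_of P \<longleftrightarrow>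
    \<bar>x \<bullet> pl_es P - pl_center P \<bullet> pl_es P\<bar> \<le> pl_a P / 2 \<and>
    \<bar>x \<bullet> pl_em P - pl_center P \<bullet> pl_em P\<bar> \<le> pl_b P / 2 \<and>
    \<bar>x \<bullet> pl_el P - pl_center P \<bullet> pl_el P\<bar> \<le> pl_l P / 2"
proof -
  let ?e = "pl_es P" and ?f = "pl_em P" and ?g = "pl_el P"
  have fr: "?e \<bullet> ?e = 1" "?f \<bullet> ?f = 1" "?g \<bullet> ?g = 1"
    "?e \<bullet> ?f = 0" "?e \<bullet> ?g = 0" "?f \<bullet> ?g = 0" "?f \<bullet> ?e = 0" "?g \<bullet> ?e = 0" "?g \<bullet> ?f = 0"
    using assms by (auto simp: orthonormal_frame_def norm_eq_1 inner_commute)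
  have "x = pl_center P + ((x - pl_center P) \<bullet> ?e) *\<^sub>R ?e
      + ((x - pl_center P) \<bullet> ?f) *\<^sub>R ?f + ((x - pl_center P) \<bullet> ?g) *\<^sub>R ?g"
    using orthonormal_expansion[OF assms, of "x - pl_center P"] by (simp add: algebra_simps)
  then show ?thesis
    unfolding carrier_of_def inner_diff_left using fr by (auto simp: inner_add_left)
qed

lemma carrier_volume:
  assumes "orthonormal_frame P" "0 \<le> pl_a P" "0 \<le> pl_b P" "0 \<le> pl_l P"
  shows "measure lebesgue (carrier_of P) = pl_a P * pl_b P * pl_l P"
proof -
  let ?e = "pl_es P" and ?f = "pl_em P" and ?g = "pl_el P"
  have fr: "norm ?e = 1" "norm ?f = 1" "norm ?g = 1" "?e \<bullet> ?f = 0" "?e \<bullet> ?g = 0" "?f \<bullet> ?g = 0"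
    using assms(1) by (auto simp: orthonormal_frame_def)
  have "cross3 ?e (cross3 ?f ?g) = 0" using fr by (simp add: Lagrange)
  moreover have "(norm (cross3 ?f ?g))\<^sup>2 = 1" using norm_cross_dot[of ?f ?g] fr by simp
  ultimately have "(?e \<bullet> cross3 ?f ?g)\<^sup>2 = 1"
    using norm_cross_dot[of ?e "cross3 ?f ?g"] fr by (simp add: power_mult_distrib)
  then have D: "\<bar>?e \<bullet> cross3 ?f ?g\<bar> = 1" by (simp add: power2_eq_1_iff) linarith
  then have nz: "?e \<bullet> cross3 ?f ?g \<noteq> 0" by auto
  have "carrier_of P = {x. \<bar>x \<bullet> ?e - pl_center P \<bullet> ?e\<bar> \<le> pl_a P / 2 \<and>
    \<bar>x \<bullet> ?f - pl_center P \<bullet> ?f\<bar> \<le> pl_b P / 2 \<and> \<bar>x \<bullet> ?g - pl_center P \<bullet> ?g\<bar> \<le> pl_l P / 2}"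
    using carrier_iff[OF assms(1)] by blast
  then show ?thesis
    using parallelepiped(2)[OF nz, of "pl_a P / 2" "pl_b P / 2" "pl_l P / 2"] assms D by simp
qed

section \<open>Cells\<close>

text \<open>
  Normals are sorted into grid cubes of side \<open>\<theta>\<close>. Each such class needs one fixed direction,
  independent of the planks, so that the slabs orthogonal to it form a partition.
\<close>

definition unit_rep :: "real \<Rightarrow> int^3 \<Rightarrow> real^3" where
  "unit_rep s g = (SOME n. norm n = 1 \<and> grid s n = g)"

lemma unit_rep:
  assumes "norm n = 1" "0 < s"
  shows "norm (unit_rep s (grid s n)) = 1" "norm (unit_rep s (grid s n) - n) \<le> 3 * s"
proof -
  have *: "norm (unit_rep s (grid s n)) = 1 \<and> grid s (unit_rep s (grid s n)) = grid s n"
    unfolding unit_rep_def by (rule someI[of "\<lambda>n'. norm n' = 1 \<and> grid s n' = grid s n" n]) (simp add: assms)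
  show "norm (unit_rep s (grid s n)) = 1" by (rule conjunct1[OF *])
  show "norm (unit_rep s (grid s n) - n) \<le> 3 * s"
    by (rule grid_eq_imp_close[OF conjunct2[OF *] assms(2)])
qed

text \<open>
  The third coordinates are compared only for equal first coordinates: positions along two
  different reference normals are unrelated.
\<close>

lemma card_close_triples:
  fixes W :: "((int^3) \<times> (int^3) \<times> int) set"
  assumes 1: "\<And>g k h g' k' h' i. (g, k, h) \<in> W \<Longrightarrow> (g', k', h') \<in> W \<Longrightarrow>
      \<bar>real_of_int (g $ i) - real_of_int (g' $ i)\<bar> \<le> a \<and>
      \<bar>real_of_int (k $ i) - real_of_int (k' $ i)\<bar> \<le> b"
    and 2: "\<And>g k h k' h'. (g, k, h) \<in> W \<Longrightarrow> (g, k', h') \<in> W \<Longrightarrow> \<bar>real_of_int h - real_of_int h'\<bar> \<le> c"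
    and nonneg: "0 \<le> a" "0 \<le> b" "0 \<le> c"
  shows "finite W \<and> real (card W) \<le> (2 * a + 1)^3 * (2 * b + 1)^3 * (2 * c + 1)"
proof -
  define G where "G = fst ` W"
  define Ks where "Ks = (fst \<circ> snd) ` W"
  define H where "H g = {h. \<exists>k. (g, k, h) \<in> W}" for g
  have G: "finite G \<and> real (card G) \<le> (2 * a + 1)^3"
  proof (rule card_close_vecs[OF _ nonneg(1)])
    fix v w i assume "v \<in> G" "w \<in> G"
    then obtain p q where "p \<in> W" "v = fst p" "q \<in> W" "w = fst q" by (auto simp: G_def)
    then show "\<bar>real_of_int (v $ i) - real_of_int (w $ i)\<bar> \<le> a"
      using 1[of "fst p" "fst (snd p)" "snd (snd p)" "fst q" "fst (snd q)" "snd (snd q)" i] by simp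
  qed
  have K: "finite Ks \<and> real (card Ks) \<le> (2 * b + 1)^3"
  proof (rule card_close_vecs[OF _ nonneg(2)])
    fix v w i assume "v \<in> Ks" "w \<in> Ks"
    then obtain p q where "p \<in> W" "v = fst (snd p)" "q \<in> W" "w = fst (snd q)" by (auto simp: Ks_def)
    then show "\<bar>real_of_int (v $ i) - real_of_int (w $ i)\<bar> \<le> b"
      using 1[of "fst p" "fst (snd p)" "snd (snd p)" "fst q" "fst (snd q)" "snd (snd q)" i] by simp
  qed
  have H: "finite (H g) \<and> real (card (H g)) \<le> 2 * c + 1" for g
    using 2 by (intro card_close_ints nonneg) (auto simp: H_def)
  let ?S = "SIGMA g:G. Ks \<times> H g"
  have sub: "W \<subseteq> ?S" by (force simp: G_def Ks_def H_def)
  have fin: "finite ?S" using G K H by auto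
  have "card W \<le> card ?S" using sub fin by (intro card_mono)
  also have "card ?S = (\<Sum>g\<in>G. card Ks * card (H g))"
    using G K H by (subst card_SigmaI) (auto simp: card_cartesian_product)
  finally have "real (card W) \<le> (\<Sum>g\<in>G. real (card Ks) * real (card (H g)))"
    by (simp flip: of_nat_mult of_nat_sum)
  also have "\<dots> \<le> (\<Sum>g\<in>G. (2 * b + 1)^3 * (2 * c + 1))"
    using K H nonneg by (intro sum_mono mult_mono) auto
  also have "\<dots> = real (card G) * ((2 * b + 1)^3 * (2 * c + 1))" by simp
  also have "\<dots> \<le> (2 * a + 1)^3 * ((2 * b + 1)^3 * (2 * c + 1))"
    using G nonneg by (intro mult_right_mono) auto
  finally show ?thesis using finite_subset[OF sub fin] by (simp add: mult.assoc)
qed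

text \<open>
  A plank consists of at most \<open>(2 C + 3) / \<rho>\<close> pieces of diameter about \<open>\<rho>\<close>, the factor 2 is for
  the two orientations of a normal, and the remaining product is the bound of the preceding
  lemma for the cells met by one piece with one orientation.
\<close>

definition cells_per_plank :: "real \<Rightarrow> real \<Rightarrow> real" where
  "cells_per_plank C K = 2 * (2 * C + 3) * 
     ((2 * (2 * K + 1) + 1)^3 * (2 * (2 * C + 2) + 1)^3 * (2 * (C + (2 * C + 1) * (3 + K) + 1) + 1))"

text \<open>
  The hypotheses at one scale, with angles expressed by \<^const>\<open>chord_dist\<close>. The condition \<open>broad\<close> is what
  remains of the assumption on subcollections: any incident label is transverse to at least
  \<open>m / 2\<close> others.
\<close>

locale transverse_planks =
  fixes C K \<alpha> \<rho> \<theta> B m :: real and I :: "nat set" and P :: "nat \<Rightarrow> plank" and Y :: "nat \<Rightarrow> (real^3) set"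
  assumes fin: "finite I"
    and comparable: "\<And>i. i \<in> I \<Longrightarrow> comparable_plank C \<alpha> \<rho> (P i)"
    and shading_measurable: "\<And>i. i \<in> I \<Longrightarrow> Y i \<in> lmeasurable"
    and shading_subset: "\<And>i. i \<in> I \<Longrightarrow> Y i \<subseteq> carrier_of (P i)"
    and pos: "0 < \<alpha>" "0 < \<rho>" "0 < \<theta>" "0 < B" "0 < m" "1 \<le> C" "1 \<le> K"
    and le: "\<rho> \<le> 1" "\<theta> \<le> 1" "\<alpha> \<le> \<theta> * \<rho>"
    and mult_ge: "\<And>x. x \<in> shaded_union I Y \<Longrightarrow> m \<le> real (card (incident I Y x))"
    and narrow: "\<And>x i j. x \<in> shaded_union I Y \<Longrightarrow> i \<in> incident I Y x \<Longrightarrow> j \<in> incident I Y x \<Longrightarrow>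
      chord_dist (pl_es (P i)) (pl_es (P j)) \<le> K * \<theta>"
    and broad: "\<And>x i. x \<in> shaded_union I Y \<Longrightarrow> i \<in> incident I Y x \<Longrightarrow>
      m / 2 \<le> real (card {j \<in> incident I Y x. \<theta> / (4 * B) \<le> chord_dist (pl_es (P i)) (pl_es (P j))})"
begin

text \<open>
  A cell fixes a class of normals up to \<open>\<theta>\<close>, a grid cube of side \<open>\<rho>\<close>, and within it a slab of
  thickness \<open>\<theta> \<rho>\<close> orthogonal to the reference normal. This is the region of dimensions
  \<open>\<theta> \<rho> \<times> \<rho> \<times> \<rho>\<close> swept out by pieces of planks with normals varying by \<open>\<theta>\<close>.
\<close>

definition cell_index :: "nat \<Rightarrow> real^3 \<Rightarrow> (int^3) \<times> (int^3) \<times> int" where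
  "cell_index i x = (let g = grid \<theta> (pl_es (P i))
     in (g, grid \<rho> x, \<lfloor>x \<bullet> unit_rep \<theta> g / (\<theta> * \<rho>)\<rfloor>))"

text \<open>
  A point belongs to the cells given by all of its incident labels. The cells are only required
  to cover \<open>V\<close>, so no measurable selection of one label per point is needed.
\<close>

definition cell :: "(real^3) set \<Rightarrow> (int^3) \<times> (int^3) \<times> int \<Rightarrow> (real^3) set" where
  "cell V T = {x \<in> V. \<exists>i\<in>incident I Y x. cell_index i x = T}"

definition cells_of :: "(real^3) set \<Rightarrow> nat \<Rightarrow> ((int^3) \<times> (int^3) \<times> int) set" where
  "cells_of V i = {T. Y i \<inter> cell V T \<noteq> {}}"

lemma frame: "i \<in> I \<Longrightarrow> orthonormal_frame (P i)"
  using comparable by (auto simp: comparable_plank_def)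

lemma norm_es: "i \<in> I \<Longrightarrow> norm (pl_es (P i)) = 1"
  using frame by (auto simp: orthonormal_frame_def)

lemma sides: 
  assumes "i \<in> I"
  shows "0 < pl_a (P i)" "pl_a (P i) \<le> C * \<alpha>" "pl_a (P i) \<le> pl_b (P i)" "pl_b (P i) \<le> C * \<rho>" "pl_l (P i) \<le> C"
    "pl_b (P i) \<le> pl_l (P i)"
proof -
  have "0 < inverse C * \<alpha>" using pos by simp
  then show "0 < pl_a (P i)" "pl_a (P i) \<le> C * \<alpha>" "pl_a (P i) \<le> pl_b (P i)" "pl_b (P i) \<le> C * \<rho>" "pl_l (P i) \<le> C"
    "pl_b (P i) \<le> pl_l (P i)"
    using comparable[OF assms] by (auto simp: comparable_plank_def)
qed

lemma carrier_thin:
  assumes "i \<in> I" "x \<in> Y i"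
  shows "\<bar>(x - pl_center (P i)) \<bullet> pl_es (P i)\<bar> \<le> C * \<alpha>"
proof -
  have "\<bar>x \<bullet> pl_es (P i) - pl_center (P i) \<bullet> pl_es (P i)\<bar> \<le> pl_a (P i) / 2"
    using carrier_iff[OF frame[OF assms(1)]] shading_subset[OF assms(1)] assms(2) by blast
  then show ?thesis using sides[OF assms(1)] by (simp add: inner_diff_left)
qed

lemma same_piece_close:
  assumes "i \<in> I" "x \<in> Y i" "y \<in> Y i"
    and "\<lfloor>x \<bullet> pl_el (P i) / \<rho>\<rfloor> = \<lfloor>y \<bullet> pl_el (P i) / \<rho>\<rfloor>"
  shows "norm (x - y) \<le> (2 * C + 1) * \<rho>" "\<bar>(x - y) \<bullet> pl_es (P i)\<bar> \<le> C * (\<theta> * \<rho>)"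
proof -
  let ?e = "pl_es (P i)" and ?f = "pl_em (P i)" and ?g = "pl_el (P i)" and ?c = "pl_center (P i)"
  have x: "\<bar>x \<bullet> ?e - ?c \<bullet> ?e\<bar> \<le> pl_a (P i) / 2" "\<bar>x \<bullet> ?f - ?c \<bullet> ?f\<bar> \<le> pl_b (P i) / 2"
    using carrier_iff[OF frame[OF assms(1)]] shading_subset[OF assms(1)] assms(2) by blast+
  have y: "\<bar>y \<bullet> ?e - ?c \<bullet> ?e\<bar> \<le> pl_a (P i) / 2" "\<bar>y \<bullet> ?f - ?c \<bullet> ?f\<bar> \<le> pl_b (P i) / 2"
    using carrier_iff[OF frame[OF assms(1)]] shading_subset[OF assms(1)] assms(3) by blast+
  have fr: "norm ?e = 1" "norm ?f = 1" "norm ?g = 1"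
    using frame[OF assms(1)] by (auto simp: orthonormal_frame_def)
  have de: "\<bar>(x - y) \<bullet> ?e\<bar> \<le> pl_a (P i)" and df: "\<bar>(x - y) \<bullet> ?f\<bar> \<le> pl_b (P i)"
    unfolding inner_diff_left using x y by linarith+
  have dg: "\<bar>(x - y) \<bullet> ?g\<bar> \<le> \<rho>"
    using floor_eq_imp_close[OF assms(4)] pos by (simp add: inner_diff_left)
  have "C * \<alpha> \<le> C * (\<theta> * \<rho>)" using le pos by (intro mult_left_mono) auto
  then show "\<bar>(x - y) \<bullet> ?e\<bar> \<le> C * (\<theta> * \<rho>)" using de sides(2)[OF assms(1)] by linarith
  have "norm (x - y) \<le> norm (((x - y) \<bullet> ?e) *\<^sub>R ?e + ((x - y) \<bullet> ?f) *\<^sub>R ?f) + norm (((x - y) \<bullet> ?g) *\<^sub>R ?g)"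
    by (subst orthonormal_expansion[OF frame[OF assms(1)], of "x - y"]) (rule norm_triangle_ineq)
  also have "\<dots> \<le> norm (((x - y) \<bullet> ?e) *\<^sub>R ?e) + norm (((x - y) \<bullet> ?f) *\<^sub>R ?f) + norm (((x - y) \<bullet> ?g) *\<^sub>R ?g)"
    by (intro add_right_mono norm_triangle_ineq)
  also have "\<dots> = \<bar>(x - y) \<bullet> ?e\<bar> + \<bar>(x - y) \<bullet> ?f\<bar> + \<bar>(x - y) \<bullet> ?g\<bar>"
    using fr by simp
  also have "\<dots> \<le> C * \<rho> + C * \<rho> + \<rho>"
    using de df dg sides[OF assms(1)] by linarith
  finally show "norm (x - y) \<le> (2 * C + 1) * \<rho>" by (simp add: algebra_simps)
qed

text \<open>
  Along one piece of a plank of label \<open>i\<close> all incident normals agree with \<open>s\<close> times that of \<open>i\<close>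
  up to \<open>K \<theta>\<close>, so few classes of normals occur. For a fixed class, the piece leaves its own
  plane by at most \<open>C \<theta> \<rho>\<close> and the tilt between the plane and the reference normal contributes
  (length) times (tilt), again \<open>O(\<theta> \<rho>)\<close>.
\<close>

lemma cell_index_spread:
  assumes i: "i \<in> I" and s: "\<bar>s\<bar> = 1"
    and x: "x \<in> Y i" "j \<in> I" "norm (pl_es (P j) - s *\<^sub>R pl_es (P i)) \<le> K * \<theta>" "cell_index j x = (g, k, h)"
    and y: "y \<in> Y i" "j' \<in> I" "norm (pl_es (P j') - s *\<^sub>R pl_es (P i)) \<le> K * \<theta>" "cell_index j' y = (g', k', h')"
    and piece: "\<lfloor>x \<bullet> pl_el (P i) / \<rho>\<rfloor> = \<lfloor>y \<bullet> pl_el (P i) / \<rho>\<rfloor>"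
  shows "\<bar>real_of_int (g $ l) - real_of_int (g' $ l)\<bar> \<le> 2 * K + 1"
    "\<bar>real_of_int (k $ l) - real_of_int (k' $ l)\<bar> \<le> 2 * C + 2"
    "g = g' \<Longrightarrow> \<bar>real_of_int h - real_of_int h'\<bar> \<le> C + (2 * C + 1) * (3 + K) + 1"
proof -
  have gk: "g = grid \<theta> (pl_es (P j))" "k = grid \<rho> x" "h = \<lfloor>x \<bullet> unit_rep \<theta> g / (\<theta> * \<rho>)\<rfloor>"
    "g' = grid \<theta> (pl_es (P j'))" "k' = grid \<rho> y" "h' = \<lfloor>y \<bullet> unit_rep \<theta> g' / (\<theta> * \<rho>)\<rfloor>"
    using x(4) y(4) by (auto simp: cell_index_def Let_def)
  note close = same_piece_close[OF i x(1) y(1) piece]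
  have "norm (pl_es (P j) - pl_es (P j')) \<le> K * \<theta> + K * \<theta>"
    using norm_triangle_ineq4[of "pl_es (P j) - s *\<^sub>R pl_es (P i)" "pl_es (P j') - s *\<^sub>R pl_es (P i)"] x(3) y(3)
    by simp
  then have "\<bar>real_of_int (g $ l) - real_of_int (g' $ l)\<bar> \<le> (K * \<theta> + K * \<theta>) / \<theta> + 1"
    unfolding gk by (rule grid_close) (rule pos)
  then show "\<bar>real_of_int (g $ l) - real_of_int (g' $ l)\<bar> \<le> 2 * K + 1" using pos by (simp add: field_simps)
  have "\<bar>real_of_int (k $ l) - real_of_int (k' $ l)\<bar> \<le> (2 * C + 1) * \<rho> / \<rho> + 1"
    unfolding gk using close(1) by (rule grid_close) (rule pos)
  then show "\<bar>real_of_int (k $ l) - real_of_int (k' $ l)\<bar> \<le> 2 * C + 2" using pos by simp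
  assume gg: "g = g'"
  let ?n = "unit_rep \<theta> g" and ?e = "pl_es (P i)" and ?e' = "pl_es (P j)"
  have n: "norm (?n - ?e') \<le> 3 * \<theta>" unfolding gk using unit_rep norm_es x(2) pos by blast
  have "norm (?n - s *\<^sub>R ?e) \<le> norm (?n - ?e') + norm (?e' - s *\<^sub>R ?e)"
    using norm_triangle_ineq[of "?n - ?e'" "?e' - s *\<^sub>R ?e"] by simp
  also have "\<dots> \<le> (3 + K) * \<theta>" using n x(3) by (simp add: algebra_simps)
  finally have ns: "norm (?n - s *\<^sub>R ?e) \<le> (3 + K) * \<theta>" .
  have "(x - y) \<bullet> ?n = s * ((x - y) \<bullet> ?e) + (x - y) \<bullet> (?n - s *\<^sub>R ?e)"
    by (simp add: inner_diff_right)
  then have "\<bar>(x - y) \<bullet> ?n\<bar> \<le> \<bar>(x - y) \<bullet> ?e\<bar> + \<bar>(x - y) \<bullet> (?n - s *\<^sub>R ?e)\<bar>"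
    using s abs_triangle_ineq[of "s * ((x - y) \<bullet> ?e)" "(x - y) \<bullet> (?n - s *\<^sub>R ?e)"] by (simp add: abs_mult)
  also have "\<bar>(x - y) \<bullet> (?n - s *\<^sub>R ?e)\<bar> \<le> norm (x - y) * norm (?n - s *\<^sub>R ?e)"
    by (rule Cauchy_Schwarz_ineq2)
  also have "\<dots> \<le> ((2 * C + 1) * \<rho>) * ((3 + K) * \<theta>)"
    using close(1) ns pos by (intro mult_mono) auto
  finally have "\<bar>x \<bullet> ?n - y \<bullet> ?n\<bar> \<le> (C + (2 * C + 1) * (3 + K)) * (\<theta> * \<rho>)"
    using close(2) by (simp add: inner_diff_left algebra_simps)
  then have "\<bar>real_of_int h - real_of_int h'\<bar> \<le> (C + (2 * C + 1) * (3 + K)) * (\<theta> * \<rho>) / (\<theta> * \<rho>) + 1"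
    unfolding gk(3,6) gg[symmetric] by (rule floor_close) (use pos in simp)
  then show "\<bar>real_of_int h - real_of_int h'\<bar> \<le> C + (2 * C + 1) * (3 + K) + 1" using pos by simp
qed

lemma card_cells_of:
  assumes V: "V \<subseteq> shaded_union I Y" and i: "i \<in> I"
  shows "finite (cells_of V i) \<and> real (card (cells_of V i)) \<le> cells_per_plank C K / \<rho>"
proof -
  let ?g = "pl_el (P i)" and ?e = "pl_es (P i)"
  define M where "M = (2 * (2 * K + 1) + 1)^3 * (2 * (2 * C + 2) + 1)^3 * (2 * (C + (2 * C + 1) * (3 + K) + 1) + 1)"
  define Q where "Q = (\<lambda>x. \<lfloor>x \<bullet> ?g / \<rho>\<rfloor>) ` Y i"
  define W where "W p s = {cell_index j x | j x. x \<in> Y i \<and> j \<in> I \<and> \<lfloor>x \<bullet> ?g / \<rho>\<rfloor> = p \<and>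
      norm (pl_es (P j) - s *\<^sub>R ?e) \<le> K * \<theta>}" for p and s :: real
  have Q: "finite Q \<and> real (card Q) \<le> 2 * (C / \<rho> + 1) + 1"
  proof (rule card_close_ints)
    fix v w assume "v \<in> Q" "w \<in> Q"
    then obtain x y where xy: "x \<in> Y i" "y \<in> Y i" and vw: "v = \<lfloor>x \<bullet> ?g / \<rho>\<rfloor>" "w = \<lfloor>y \<bullet> ?g / \<rho>\<rfloor>"
      by (auto simp: Q_def)
    have "\<bar>x \<bullet> ?g - pl_center (P i) \<bullet> ?g\<bar> \<le> pl_l (P i) / 2" "\<bar>y \<bullet> ?g - pl_center (P i) \<bullet> ?g\<bar> \<le> pl_l (P i) / 2"
      using carrier_iff[OF frame[OF i]] shading_subset[OF i] xy by blast+
    then have "\<bar>x \<bullet> ?g - y \<bullet> ?g\<bar> \<le> C" using sides(5)[OF i] by linarith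
    then show "\<bar>real_of_int v - real_of_int w\<bar> \<le> C / \<rho> + 1"
      unfolding vw by (rule floor_close) (rule pos)
  qed (use pos in auto)
  have W: "finite (W p s) \<and> real (card (W p s)) \<le> M" if "\<bar>s\<bar> = 1" for p s
    unfolding M_def
  proof (rule card_close_triples)
    fix g k h g' k' h' l assume T: "(g, k, h) \<in> W p s" "(g', k', h') \<in> W p s"
    obtain x j where x: "x \<in> Y i" "j \<in> I" "norm (pl_es (P j) - s *\<^sub>R ?e) \<le> K * \<theta>" "cell_index j x = (g, k, h)"
      and px: "\<lfloor>x \<bullet> ?g / \<rho>\<rfloor> = p" using T(1) unfolding W_def by (smt (verit) mem_Collect_eq)
    obtain y j' where y: "y \<in> Y i" "j' \<in> I" "norm (pl_es (P j') - s *\<^sub>R ?e) \<le> K * \<theta>" "cell_index j' y = (g', k', h')"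
      and py: "\<lfloor>y \<bullet> ?g / \<rho>\<rfloor> = p" using T(2) unfolding W_def by (smt (verit) mem_Collect_eq)
    note spread = cell_index_spread[OF i that x y, unfolded px py, OF refl]
    show "\<bar>real_of_int (g $ l) - real_of_int (g' $ l)\<bar> \<le> 2 * K + 1 \<and>
      \<bar>real_of_int (k $ l) - real_of_int (k' $ l)\<bar> \<le> 2 * C + 2"
      using spread(1,2) by blast
  next
    fix g k h k' h' assume T: "(g, k, h) \<in> W p s" "(g, k', h') \<in> W p s"
    obtain x j where x: "x \<in> Y i" "j \<in> I" "norm (pl_es (P j) - s *\<^sub>R ?e) \<le> K * \<theta>" "cell_index j x = (g, k, h)"
      and px: "\<lfloor>x \<bullet> ?g / \<rho>\<rfloor> = p" using T(1) unfolding W_def by (smt (verit) mem_Collect_eq)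
    obtain y j' where y: "y \<in> Y i" "j' \<in> I" "norm (pl_es (P j') - s *\<^sub>R ?e) \<le> K * \<theta>" "cell_index j' y = (g, k', h')"
      and py: "\<lfloor>y \<bullet> ?g / \<rho>\<rfloor> = p" using T(2) unfolding W_def by (smt (verit) mem_Collect_eq)
    show "\<bar>real_of_int h - real_of_int h'\<bar> \<le> C + (2 * C + 1) * (3 + K) + 1"
      using cell_index_spread(3)[OF i that x y, unfolded px py, OF refl refl] .
  qed (use pos in auto)
  have M0: "0 \<le> M" using pos by (simp add: M_def)
  have sub: "cells_of V i \<subseteq> (\<Union>p\<in>Q. W p 1 \<union> W p (-1))"
  proof
    fix T assume "T \<in> cells_of V i"
    then obtain x j where x: "x \<in> Y i" "x \<in> V" "j \<in> incident I Y x" "cell_index j x = T"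
      by (auto simp: cells_of_def cell_def)
    have "i \<in> incident I Y x" using i x by (simp add: incident_def)
    then have "chord_dist (pl_es (P j)) ?e \<le> K * \<theta>" using narrow x V by blast
    then have "norm (pl_es (P j) - 1 *\<^sub>R ?e) \<le> K * \<theta> \<or> norm (pl_es (P j) - (-1) *\<^sub>R ?e) \<le> K * \<theta>"
      by (auto simp: chord_dist_def min_def split: if_splits)
    moreover have "j \<in> I" using x by (simp add: incident_def)
    ultimately have "T \<in> W \<lfloor>x \<bullet> ?g / \<rho>\<rfloor> 1 \<or> T \<in> W \<lfloor>x \<bullet> ?g / \<rho>\<rfloor> (-1)"
      unfolding W_def using x by blast
    moreover have "\<lfloor>x \<bullet> ?g / \<rho>\<rfloor> \<in> Q" using x by (simp add: Q_def)
    ultimately show "T \<in> (\<Union>p\<in>Q. W p 1 \<union> W p (-1))" by blast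
  qed
  have f1: "finite (\<Union>p\<in>Q. W p 1 \<union> W p (-1))" using Q W[of 1] W[of "-1"] by auto
  have "card (cells_of V i) \<le> (\<Sum>p\<in>Q. card (W p 1 \<union> W p (-1)))"
    using card_mono[OF f1 sub] card_UN_le[of Q "\<lambda>p. W p 1 \<union> W p (-1)"] Q by linarith
  also have "\<dots> \<le> (\<Sum>p\<in>Q. card (W p 1) + card (W p (-1)))"
    by (intro sum_mono card_Un_le)
  finally have "real (card (cells_of V i)) \<le> (\<Sum>p\<in>Q. real (card (W p 1)) + real (card (W p (-1))))"
    by (simp flip: of_nat_add of_nat_sum)
  also have "\<dots> \<le> (\<Sum>p\<in>Q. 2 * M)"
  proof (rule sum_mono)
    fix p show "real (card (W p 1)) + real (card (W p (-1))) \<le> 2 * M"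
      using W[of 1 p] W[of "-1" p] by simp
  qed
  also have "\<dots> = real (card Q) * (2 * M)" by simp
  also have "\<dots> \<le> ((2 * C + 3) / \<rho>) * (2 * M)"
  proof (intro mult_right_mono)
    have "2 * (C / \<rho> + 1) + 1 \<le> (2 * C + 3) / \<rho>"
      using pos le by (simp add: field_simps)
    then show "real (card Q) \<le> (2 * C + 3) / \<rho>" using Q by linarith
  qed (use M0 in auto)
  also have "\<dots> = cells_per_plank C K / \<rho>" unfolding cells_per_plank_def M_def[symmetric] by (simp add: field_simps)
  finally show ?thesis using finite_subset[OF sub f1] by blast
qed

lemma shaded_union_lmeasurable: "shaded_union I Y \<in> lmeasurable"
  unfolding shaded_union_def using fin shading_measurable by (intro fmeasurable.finite_UN) auto

lemma cell_sets:
  assumes "V \<in> sets lebesgue" shows "cell V T \<in> sets lebesgue"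
proof -
  obtain g k h where T: "T = (g, k, h)" by (cases T) auto
  define A where "A = (\<Union>i\<in>{i \<in> I. grid \<theta> (pl_es (P i)) = g}. Y i)"
  have "cell V T = V \<inter> A \<inter> cube \<rho> k \<inter> {x. \<lfloor>x \<bullet> unit_rep \<theta> g / (\<theta> * \<rho>)\<rfloor> = h}"
    by (auto simp: T A_def cell_def cell_index_def Let_def incident_def cube_def)
  moreover have "A \<in> sets lebesgue"
    unfolding A_def using fin shading_measurable by (intro sets.finite_UN) auto
  moreover have "{x. \<lfloor>x \<bullet> unit_rep \<theta> g / (\<theta> * \<rho>)\<rfloor> = h} \<in> sets lebesgue"
    using floor_preimage_borel[of "\<lambda>x. x \<bullet> unit_rep \<theta> g / (\<theta> * \<rho>)" h] pos
    by (auto intro!: continuous_intros)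
  moreover have "cube \<rho> k \<in> sets lebesgue" using cube_borel by auto
  ultimately show ?thesis using assms by (simp add: sets.Int)
qed

lemma cell_close:
  assumes "x \<in> cell V T" "y \<in> cell V T"
  shows "norm (x - y) \<le> 3 * \<rho>"
  using assms by (intro grid_eq_imp_close pos) (auto simp: cell_def cell_index_def Let_def)

lemma cell_bounded: "bounded (cell V T)"
  using cell_close by (metis bounded_two_points dist_norm)

section \<open>The bilinear estimate\<close>

lemma cell_pair_volume:
  assumes V: "V \<in> sets lebesgue" and ij: "i \<in> I" "j \<in> I"
    and far: "\<theta> / (4 * B) \<le> chord_dist (pl_es (P i)) (pl_es (P j))"
  shows "measure lebesgue (cell V T \<inter> (Y i \<inter> Y j)) \<le> 192 * C\<^sup>2 * \<alpha>\<^sup>2 * \<rho> * B / \<theta>"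
proof (cases "cell V T = {}")
  case True
  then show ?thesis using pos by simp
next
  case False
  then obtain x0 where x0: "x0 \<in> cell V T" by auto
  have "measure lebesgue (cell V T \<inter> (Y i \<inter> Y j)) \<le> 16 * (C * \<alpha>)\<^sup>2 * (3 * \<rho>) / (\<theta> / (4 * B))"
  proof (rule two_slabs_volume[OF norm_es[OF ij(1)] norm_es[OF ij(2)] _ far])
    show "cell V T \<inter> (Y i \<inter> Y j) \<in> sets lebesgue"
      using cell_sets[OF V, of T] shading_measurable[OF ij(1)] shading_measurable[OF ij(2)]
      by (simp add: sets.Int fmeasurableD)
    fix x assume "x \<in> cell V T \<inter> (Y i \<inter> Y j)"
    then show "\<bar>(x - pl_center (P i)) \<bullet> pl_es (P i)\<bar> \<le> C * \<alpha> \<and>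
      \<bar>(x - pl_center (P j)) \<bullet> pl_es (P j)\<bar> \<le> C * \<alpha> \<and> norm (x - x0) \<le> 3 * \<rho>"
      using carrier_thin ij cell_close x0 by blast
  qed (use pos in auto)
  also have "\<dots> = 192 * C\<^sup>2 * \<alpha>\<^sup>2 * \<rho> * B / \<theta>"
    using pos by (simp add: field_simps power_mult_distrib)
  finally show ?thesis .
qed

text \<open>
  The cubes of side \<open>\<theta> \<rho>\<close> that meet a cell stay in a slab of thickness \<open>O(\<theta> \<rho>)\<close> and width
  \<open>O(\<rho>)\<close>, so a sparse set occupies only the fraction \<open>\<tau>\<close> of the volume \<open>\<theta> \<rho>\<^sup>3\<close> of that slab.
\<close>

lemma cell_volume:
  assumes V: "V \<in> sets lebesgue" and \<tau>: "0 \<le> \<tau>"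
    and sparse: "\<And>x. x \<in> V \<Longrightarrow> measure lebesgue (V \<inter> cube (\<theta> * \<rho>) (grid (\<theta> * \<rho>) x))
        \<le> \<tau> * measure lebesgue (cube (\<theta> * \<rho>) (grid (\<theta> * \<rho>) x))"
  shows "measure lebesgue (cell V T) \<le> \<tau> * (1152 * \<theta> * \<rho>^3)"
proof (cases "cell V T = {}")
  case True
  then show ?thesis using pos \<tau> by simp
next
  case False
  then obtain x0 where x0: "x0 \<in> cell V T" by auto
  let ?r = "\<theta> * \<rho>"
  have r: "0 < ?r" "?r \<le> \<rho>" using pos le by (auto simp: mult_left_le_one_le)
  obtain g k h where T: "T = (g, k, h)" by (cases T) auto
  let ?n = "unit_rep \<theta> g"
  obtain i where "i \<in> I" "g = grid \<theta> (pl_es (P i))"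
    using x0 by (auto simp: T cell_def incident_def cell_index_def Let_def)
  then have n: "norm ?n = 1" using unit_rep norm_es pos by blast
  have floor: "\<lfloor>x \<bullet> ?n / ?r\<rfloor> = h" if "x \<in> cell V T" for x
    using that by (auto simp: T cell_def cell_index_def Let_def)
  let ?S = "\<Union>v\<in>grid ?r ` cell V T. cube ?r v"
  have "measure lebesgue (cell V T) \<le> \<tau> * measure lebesgue ?S"
    using cell_sets[OF V] cell_bounded r sparse
    by (intro sparse_subset_volume[OF _ V]) (auto simp: cell_def)
  also have "measure lebesgue ?S \<le> 8 * (4 * ?r) * (6 * \<rho>)\<^sup>2"
  proof (rule slab_volume[OF n, of _ _ _ x0])
    show "?S \<in> sets lebesgue"
      using finite_grid_image[OF cell_bounded r(1)] cube_borel by (intro sets.finite_UN) auto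
    fix y assume "y \<in> ?S"
    then obtain x where x: "x \<in> cell V T" "grid ?r y = grid ?r x" by (auto simp: cube_def)
    have yx: "norm (y - x) \<le> 3 * ?r" using grid_eq_imp_close[OF x(2) r(1)] .
    have "\<bar>x \<bullet> ?n - x0 \<bullet> ?n\<bar> \<le> ?r"
      using floor_eq_imp_close[of "x \<bullet> ?n" ?r "x0 \<bullet> ?n"] floor x(1) x0 r(1) by simp
    moreover have "\<bar>(y - x) \<bullet> ?n\<bar> \<le> norm (y - x)"
      using Cauchy_Schwarz_ineq2[of "y - x" ?n] n by simp
    ultimately have "\<bar>(y - x0) \<bullet> ?n\<bar> \<le> 4 * ?r"
      using yx unfolding inner_diff_left by linarith
    moreover have "norm (y - x0) \<le> norm (y - x) + norm (x - x0)"
      using norm_triangle_ineq[of "y - x" "x - x0"] by simp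
    then have "norm (y - x0) \<le> 6 * \<rho>" using cell_close[OF x(1) x0] yx r(2) by linarith
    ultimately show "\<bar>(y - x0) \<bullet> ?n\<bar> \<le> 4 * ?r \<and> norm (y - x0) \<le> 6 * \<rho>" by blast
  qed (use r pos in auto)
  also have "8 * (4 * ?r) * (6 * \<rho>)\<^sup>2 = 1152 * \<theta> * \<rho>^3"
    by (simp add: power2_eq_square power3_eq_cube)
  finally show ?thesis using \<tau> by (simp add: mult_left_mono)
qed

text \<open>
  Cordoba's argument in a single cell \<open>T\<close>, met by \<open>N\<close> shadings. Each point has at least
  \<open>m\<^sup>2 / 2\<close> transverse incident pairs, whence \<open>m\<^sup>2 |T| \<lesssim> N\<^sup>2 \<alpha>\<^sup>2 \<rho> B / \<theta>\<close>. Multiplying with the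
  sparsity bound \<open>|T| \<lesssim> \<sigma>\<^sup>2 \<theta> \<rho>\<^sup>3 / B\<close> cancels \<open>\<theta>\<close> and \<open>B\<close>, and the root \<open>m |T| \<lesssim> \<sigma> \<alpha> \<rho>\<^sup>2 N\<close> is
  linear in \<open>N\<close>, hence can be summed over the cells without any information on how the mass of a
  shading is distributed among them.
\<close>

lemma cell_multiplicity_bound:
  assumes V: "V \<in> sets lebesgue" "V \<subseteq> shaded_union I Y" and \<sigma>: "0 \<le> \<sigma>"
    and sparse: "\<And>x. x \<in> V \<Longrightarrow> measure lebesgue (V \<inter> cube (\<theta> * \<rho>) (grid (\<theta> * \<rho>) x))
        \<le> \<sigma>\<^sup>2 / B * measure lebesgue (cube (\<theta> * \<rho>) (grid (\<theta> * \<rho>) x))"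
  shows "m * measure lebesgue (cell V T) \<le> 666 * C * \<sigma> * \<alpha> * \<rho>\<^sup>2 * real (card {i\<in>I. T \<in> cells_of V i})"
proof -
  let ?A = "cell V T" and ?J = "{i\<in>I. T \<in> cells_of V i}"
  let ?far = "\<lambda>i j. \<theta> / (4 * B) \<le> chord_dist (pl_es (P i)) (pl_es (P j))"
  define N where "N = real (card ?J)"
  define R where "R = {(i, j) \<in> ?J \<times> ?J. ?far i j}"
  have finR: "finite R" using fin by (auto simp: R_def intro: finite_subset[of _ "I \<times> I"])
  have A: "?A \<in> lmeasurable" using cell_sets[OF V(1)] cell_bounded by (intro bounded_set_imp_lmeasurable)
  have many: "m * (m / 2) \<le> real (card {r \<in> R. x \<in> (case r of (i, j) \<Rightarrow> Y i \<inter> Y j)})" if x: "x \<in> ?A" for x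
  proof -
    have xU: "x \<in> shaded_union I Y" using x V by (auto simp: cell_def)
    let ?In = "incident I Y x"
    have fI: "finite ?In" using fin by (simp add: incident_def)
    have "m * (m / 2) \<le> real (card ?In) * (m / 2)" using mult_ge[OF xU] pos by (intro mult_right_mono) auto
    also have "\<dots> = (\<Sum>i\<in>?In. m / 2)" by simp
    also have "\<dots> \<le> (\<Sum>i\<in>?In. real (card {j \<in> ?In. ?far i j}))" using broad[OF xU] by (intro sum_mono) auto
    also have "\<dots> = real (card (SIGMA i:?In. {j \<in> ?In. ?far i j}))" using fI by simp
    also have "\<dots> \<le> real (card {r \<in> R. x \<in> (case r of (i, j) \<Rightarrow> Y i \<inter> Y j)})"
    proof -
      have "?In \<subseteq> ?J" using x by (auto simp: cells_of_def incident_def)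
      then have "(SIGMA i:?In. {j \<in> ?In. ?far i j}) \<subseteq> {r \<in> R. x \<in> (case r of (i, j) \<Rightarrow> Y i \<inter> Y j)}"
        by (auto simp: R_def incident_def)
      then show ?thesis using finR by (intro of_nat_mono card_mono) auto
    qed
    finally show ?thesis .
  qed
  have "m * (m / 2) * measure lebesgue ?A \<le> (\<Sum>r\<in>R. measure lebesgue (?A \<inter> (case r of (i, j) \<Rightarrow> Y i \<inter> Y j)))"
    using many shading_measurable
    by (intro double_count_ge[OF finR A]) (auto simp: R_def)
  also have "\<dots> \<le> (\<Sum>r\<in>R. 192 * C\<^sup>2 * \<alpha>\<^sup>2 * \<rho> * B / \<theta>)"
    using cell_pair_volume[OF V(1), where T = T] by (intro sum_mono) (auto simp: R_def)
  also have "\<dots> = real (card R) * (192 * C\<^sup>2 * \<alpha>\<^sup>2 * \<rho> * B / \<theta>)" by simp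
  also have "\<dots> \<le> N\<^sup>2 * (192 * C\<^sup>2 * \<alpha>\<^sup>2 * \<rho> * B / \<theta>)"
  proof (intro mult_right_mono)
    have "card R \<le> card (?J \<times> ?J)" using fin by (intro card_mono) (auto simp: R_def)
    then have "real (card R) \<le> real (card ?J * card ?J)" unfolding card_cartesian_product by (rule of_nat_mono)
    then show "real (card R) \<le> N\<^sup>2" by (simp add: N_def power2_eq_square)
  qed (use pos in simp)
  finally have 1: "m * (m / 2) * measure lebesgue ?A \<le> N\<^sup>2 * (192 * C\<^sup>2 * \<alpha>\<^sup>2 * \<rho> * B / \<theta>)" .
  have 2: "measure lebesgue ?A \<le> \<sigma>\<^sup>2 / B * (1152 * \<theta> * \<rho>^3)"
    using pos sparse by (intro cell_volume[OF V(1)]) auto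
  \<comment> \<open>The constant is \<open>2 * 192 * 1152 = 442368\<close>, rounded up to the square \<open>666\<^sup>2\<close>.\<close>
  have "(m * measure lebesgue ?A)\<^sup>2 = 2 * (m * (m / 2) * measure lebesgue ?A) * measure lebesgue ?A"
    by (simp add: power2_eq_square)
  also have "\<dots> \<le> 2 * (N\<^sup>2 * (192 * C\<^sup>2 * \<alpha>\<^sup>2 * \<rho> * B / \<theta>)) * (\<sigma>\<^sup>2 / B * (1152 * \<theta> * \<rho>^3))"
    by (rule mult_mono[OF mult_left_mono[OF 1] 2]) (use pos in auto)
  also have "\<dots> = 442368 * (C * \<sigma> * \<alpha> * \<rho>\<^sup>2 * N)\<^sup>2"
    using pos by (simp add: field_simps power2_eq_square power3_eq_cube)
  also have "\<dots> \<le> 443556 * (C * \<sigma> * \<alpha> * \<rho>\<^sup>2 * N)\<^sup>2" by (intro mult_right_mono) auto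
  also have "\<dots> = (666 * C * \<sigma> * \<alpha> * \<rho>\<^sup>2 * N)\<^sup>2" by (simp add: power_mult_distrib)
  finally have "(m * measure lebesgue ?A)\<^sup>2 \<le> (666 * C * \<sigma> * \<alpha> * \<rho>\<^sup>2 * N)\<^sup>2" .
  then show ?thesis
    unfolding N_def[symmetric] by (rule power2_le_imp_le) (use pos \<sigma> in \<open>simp add: N_def\<close>)
qed

text \<open>
  Summing over the cells counts each label at most \<open>O(1 / \<rho>)\<close> times; the resulting \<open>\<alpha> \<rho>\<close> per
  label is the volume of its plank. So the mass over a sparse set is at most a multiple of \<open>\<sigma>\<close>
  times the total volume of the planks.
\<close>

lemma sparse_part_small:
  assumes V: "V \<in> sets lebesgue" "V \<subseteq> shaded_union I Y" and \<sigma>: "0 \<le> \<sigma>"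
    and sparse: "\<And>x. x \<in> V \<Longrightarrow> measure lebesgue (V \<inter> cube (\<theta> * \<rho>) (grid (\<theta> * \<rho>) x))
        \<le> \<sigma>\<^sup>2 / B * measure lebesgue (cube (\<theta> * \<rho>) (grid (\<theta> * \<rho>) x))"
  shows "m * measure lebesgue V \<le> 666 * C * cells_per_plank C K * \<sigma> * (\<alpha> * \<rho> * real (card I))"
proof -
  define TT where "TT = (\<Union>i\<in>I. cells_of V i)"
  have finT: "finite TT" unfolding TT_def using fin card_cells_of[OF V(2)] by auto
  have cover: "V \<subseteq> (\<Union>T\<in>TT. cell V T)"
  proof
    fix x assume x: "x \<in> V"
    then obtain i where i: "i \<in> I" "x \<in> Y i" using V by (auto simp: shaded_union_def)
    then have "x \<in> cell V (cell_index i x)" using x by (auto simp: cell_def incident_def)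
    moreover from this have "cell_index i x \<in> TT" using i by (auto simp: TT_def cells_of_def)
    ultimately show "x \<in> (\<Union>T\<in>TT. cell V T)" by blast
  qed
  have cm: "cell V T \<in> lmeasurable" for T
    using cell_sets[OF V(1)] cell_bounded by (intro bounded_set_imp_lmeasurable)
  have "measure lebesgue V \<le> measure lebesgue (\<Union>T\<in>TT. cell V T)"
    using cover V finT cm by (intro measure_mono_fmeasurable fmeasurable.finite_UN) auto
  also have "\<dots> \<le> (\<Sum>T\<in>TT. measure lebesgue (cell V T))"
    using finT cm by (intro measure_UNION_le) auto
  finally have "m * measure lebesgue V \<le> (\<Sum>T\<in>TT. m * measure lebesgue (cell V T))"
    using pos by (simp add: sum_distrib_left[symmetric])
  also have "\<dots> \<le> (\<Sum>T\<in>TT. 666 * C * \<sigma> * \<alpha> * \<rho>\<^sup>2 * real (card {i\<in>I. T \<in> cells_of V i}))"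
    using cell_multiplicity_bound[OF V \<sigma> sparse] by (intro sum_mono) auto
  also have "\<dots> = 666 * C * \<sigma> * \<alpha> * \<rho>\<^sup>2 * (\<Sum>T\<in>TT. real (card {i\<in>I. T \<in> cells_of V i}))"
    by (simp add: sum_distrib_left)
  also have "(\<Sum>T\<in>TT. real (card {i\<in>I. T \<in> cells_of V i})) = (\<Sum>i\<in>I. real (card {T\<in>TT. T \<in> cells_of V i}))"
    using sum_multicount_gen[of TT I "\<lambda>T i. T \<in> cells_of V i" "\<lambda>i. card {T\<in>TT. T \<in> cells_of V i}"] finT fin
    by (simp flip: of_nat_sum)
  also have "\<dots> \<le> (\<Sum>i\<in>I. cells_per_plank C K / \<rho>)"
  proof (rule sum_mono)
    fix i assume i: "i \<in> I"
    have "{T\<in>TT. T \<in> cells_of V i} = cells_of V i" using i by (auto simp: TT_def)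
    then show "real (card {T\<in>TT. T \<in> cells_of V i}) \<le> cells_per_plank C K / \<rho>"
      using card_cells_of[OF V(2) i] by simp
  qed
  also have "\<dots> = real (card I) * (cells_per_plank C K / \<rho>)" by simp
  finally have "m * measure lebesgue V \<le> 666 * C * \<sigma> * \<alpha> * \<rho>\<^sup>2 * (real (card I) * (cells_per_plank C K / \<rho>))"
    using pos \<sigma> by (simp add: mult_left_mono)
  also have "\<dots> = 666 * C * cells_per_plank C K * \<sigma> * (\<alpha> * \<rho> * real (card I))"
    using pos by (simp add: power2_eq_square)
  finally show ?thesis .
qed

section \<open>The refinement\<close>

definition dense_part :: "real \<Rightarrow> (real^3) set" where
  "dense_part \<tau> = {x \<in> shaded_union I Y.
     \<tau> * measure lebesgue (cube (\<theta> * \<rho>) (grid (\<theta> * \<rho>) x))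
       < measure lebesgue (shaded_union I Y \<inter> cube (\<theta> * \<rho>) (grid (\<theta> * \<rho>) x))}"

lemma dense_part_sets: "dense_part \<tau> \<in> sets lebesgue"
proof -
  let ?U = "shaded_union I Y" and ?Q = "cube (\<theta> * \<rho>)"
  have "dense_part \<tau> = (\<Union>v\<in>{v. \<tau> * measure lebesgue (?Q v) < measure lebesgue (?U \<inter> ?Q v)}. ?U \<inter> ?Q v)"
    by (auto simp: dense_part_def cube_def)
  also have "\<dots> \<in> sets lebesgue"
    using shaded_union_lmeasurable cube_borel by (intro sets.countable_UN' countableI_type) auto
  finally show ?thesis .
qed

text \<open>
  A ball of radius \<open>r\<close> that meets the dense part meets one of its cubes, of diameter at most
  \<open>3 r\<close>, and the shaded points of that cube all survive. The ball of radius \<open>4 r\<close> lies in a cube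
  of volume \<open>512 r\<^sup>3\<close>.
\<close>

lemma dense_part_fills_balls:
  assumes "0 \<le> \<tau>" "dense_part \<tau> \<inter> cball y (\<theta> * \<rho>) \<noteq> {}"
  shows "\<tau> / 512 \<le> measure lebesgue (dense_part \<tau> \<inter> cball y (4 * (\<theta> * \<rho>))) / measure lebesgue (cball y (4 * (\<theta> * \<rho>)))"
proof -
  let ?r = "\<theta> * \<rho>" and ?U = "shaded_union I Y"
  let ?b = "cball y (4 * ?r)"
  have r: "0 < ?r" using pos by simp
  obtain x where x: "x \<in> dense_part \<tau>" "dist y x \<le> ?r" using assms(2) by auto
  let ?q = "cube ?r (grid ?r x)"
  have "?U \<inter> ?q \<subseteq> dense_part \<tau> \<inter> ?b"
  proof
    fix u assume u: "u \<in> ?U \<inter> ?q"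
    then have "grid ?r u = grid ?r x" by (simp add: cube_def)
    then have "norm (u - x) \<le> 3 * ?r" using r by (rule grid_eq_imp_close)
    then have "dist y u \<le> 4 * ?r" using x(2) dist_triangle[of y u x] by (simp add: dist_norm norm_minus_commute)
    then show "u \<in> dense_part \<tau> \<inter> ?b" using u x(1) by (auto simp: dense_part_def cube_def)
  qed
  then have "measure lebesgue (?U \<inter> ?q) \<le> measure lebesgue (dense_part \<tau> \<inter> ?b)"
    using shaded_union_lmeasurable cube_borel dense_part_sets
    by (intro measure_mono_fmeasurable bounded_set_imp_lmeasurable sets.Int) (auto intro: bounded_subset[OF bounded_cball])
  moreover have "\<tau> * ?r^3 \<le> \<tau> * measure lebesgue ?q"
    using cube_volume_ge[OF r] assms(1) by (intro mult_left_mono)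
  moreover have "\<tau> * measure lebesgue ?q < measure lebesgue (?U \<inter> ?q)" using x(1) by (simp add: dense_part_def)
  ultimately have lower: "\<tau> * ?r^3 \<le> measure lebesgue (dense_part \<tau> \<inter> ?b)" by linarith
  have upper: "measure lebesgue ?b \<le> 512 * ?r^3"
  proof -
    define a b :: "real^3" where "a = (\<chi> i. y $ i - 4 * ?r)" and "b = (\<chi> i. y $ i + 4 * ?r)"
    have "?b \<subseteq> cbox a b"
    proof
      fix u assume "u \<in> ?b"
      then have "norm (u - y) \<le> 4 * ?r" by (simp add: dist_norm norm_minus_commute)
      then have "\<bar>u $ i - y $ i\<bar> \<le> 4 * ?r" for i
        using component_le_norm_cart[of "u - y" i] by simp
      then show "u \<in> cbox a b"
        by (simp add: mem_box_cart a_def b_def abs_le_iff) (smt (verit))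
    qed
    then have "measure lebesgue ?b \<le> measure lebesgue (cbox a b)"
      by (intro measure_mono_fmeasurable) auto
    also have "cbox a b \<noteq> {}" using r by (auto simp: interval_ne_empty_cart a_def b_def)
    then have "measure lebesgue (cbox a b) = 512 * ?r^3"
      by (simp add: content_cbox_cart a_def b_def algebra_simps power3_eq_cube)
    finally show ?thesis .
  qed
  have b: "0 < measure lebesgue ?b" using content_cball_pos[of "4 * ?r" y] r by simp
  have "\<tau> / 512 * measure lebesgue ?b \<le> \<tau> / 512 * (512 * ?r^3)"
    using upper assms(1) by (intro mult_left_mono) auto
  then have "\<tau> / 512 * measure lebesgue ?b \<le> measure lebesgue (dense_part \<tau> \<inter> ?b)" using lower by simp
  then show ?thesis using b by (subst pos_le_divide_eq)
qed

text \<open>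
  The discarded points form a sparse set, so \<open>m\<close> times their measure is at most a quarter of the
  mass when \<open>\<sigma>\<close> is a small multiple of the shading density. As the multiplicities lie between
  \<open>m\<close> and \<open>2 m\<close>, the total measure times \<open>m\<close> is at least half of the mass, and what survives
  carries at least the difference.
\<close>

lemma dense_part_keeps_mass:
  assumes mult_le: "\<And>x. x \<in> shaded_union I Y \<Longrightarrow> real (card (incident I Y x)) \<le> 2 * m"
    and \<sigma>: "0 \<le> \<sigma>"
    and small: "666 * C * cells_per_plank C K * \<sigma> * (\<alpha> * \<rho> * real (card I)) \<le> shaded_mass I Y / 4"
  shows "shaded_mass I Y / 4 \<le> shaded_mass I (\<lambda>i. Y i \<inter> dense_part (\<sigma>\<^sup>2 / B))"
proof -
  let ?U = "shaded_union I Y" and ?W = "dense_part (\<sigma>\<^sup>2 / B)"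
  let ?V = "?U - ?W"
  note U = shaded_union_lmeasurable
  have WU: "?W \<subseteq> ?U" by (auto simp: dense_part_def)
  have W: "?W \<in> lmeasurable" by (rule fmeasurableI2[OF U WU dense_part_sets])
  have "m * measure lebesgue ?V \<le> 666 * C * cells_per_plank C K * \<sigma> * (\<alpha> * \<rho> * real (card I))"
  proof (rule sparse_part_small[OF _ _ \<sigma>])
    show V: "?V \<in> sets lebesgue" using U dense_part_sets by auto
    fix x assume x: "x \<in> ?V"
    let ?q = "cube (\<theta> * \<rho>) (grid (\<theta> * \<rho>) x)"
    have "measure lebesgue (?V \<inter> ?q) \<le> measure lebesgue (?U \<inter> ?q)"
      using U V cube_borel by (intro measure_mono_fmeasurable fmeasurable_Int_fmeasurable sets.Int) auto
    also have "\<dots> \<le> \<sigma>\<^sup>2 / B * measure lebesgue ?q" using x by (auto simp: dense_part_def not_less)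
    finally show "measure lebesgue (?V \<inter> ?q) \<le> \<sigma>\<^sup>2 / B * measure lebesgue ?q" .
  qed auto
  then have V: "m * measure lebesgue ?V \<le> shaded_mass I Y / 4" using small by linarith
  have "shaded_mass I Y = (\<Sum>i\<in>I. measure lebesgue (?U \<inter> Y i))"
    unfolding shaded_mass_def by (intro sum.cong refl arg_cong[where f = "measure lebesgue"]) (auto simp: shaded_union_def)
  also have "\<dots> \<le> 2 * m * measure lebesgue ?U"
    using mult_le shading_measurable by (intro double_count_le[OF fin U]) (auto simp: incident_def)
  finally have M: "shaded_mass I Y \<le> 2 * m * measure lebesgue ?U" .
  have "m * measure lebesgue ?W \<le> (\<Sum>i\<in>I. measure lebesgue (?W \<inter> Y i))"
    using mult_ge shading_measurable WU by (intro double_count_ge[OF fin W]) (auto simp: incident_def)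
  also have "\<dots> = shaded_mass I (\<lambda>i. Y i \<inter> ?W)" by (simp add: shaded_mass_def Int_commute)
  finally have "m * measure lebesgue ?W \<le> shaded_mass I (\<lambda>i. Y i \<inter> ?W)" .
  moreover have "measure lebesgue ?V = measure lebesgue ?U - measure lebesgue ?W"
    using U W WU by (intro measure_Diff) (auto dest: fmeasurableD2 simp del: emeasure_completion)
  then have "m * measure lebesgue ?V = m * measure lebesgue ?U - m * measure lebesgue ?W" by (simp add: right_diff_distrib)
  ultimately show ?thesis using V M by linarith
qed

end

section \<open>Angular diameters\<close>

lemma plane_angle_le_angular_diameter:
  assumes "finite S" "i \<in> S" "j \<in> S"
  shows "plane_angle (long_plane (P i)) (long_plane (P j)) \<le> angular_diameter P S"
proof -
  have "finite {plane_angle (long_plane (P i)) (long_plane (P j)) | i j. i \<in> S \<and> j \<in> S}"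
    using assms(1) by (intro finite_image_set2) auto
  then show ?thesis unfolding angular_diameter_def using assms by (intro Max_ge) auto
qed

lemma angular_diameter_le:
  assumes "finite S" "S \<noteq> {}"
    and "\<And>i j. i \<in> S \<Longrightarrow> j \<in> S \<Longrightarrow> plane_angle (long_plane (P i)) (long_plane (P j)) \<le> t"
  shows "angular_diameter P S \<le> t"
proof -
  have "finite {plane_angle (long_plane (P i)) (long_plane (P j)) | i j. i \<in> S \<and> j \<in> S}"
    using assms(1) by (intro finite_image_set2) auto
  moreover have "{plane_angle (long_plane (P i)) (long_plane (P j)) | i j. i \<in> S \<and> j \<in> S} \<noteq> {}"
    using assms(2) by blast
  ultimately show ?thesis unfolding angular_diameter_def using assms(3) by (subst Max_le_iff) auto
qed

text \<open>
  The truncation at 1 costs the factor: a chord never exceeds 2.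
\<close>

lemma chord_dist_le_plane_angle:
  assumes "orthonormal_frame P" "orthonormal_frame Q"
  shows "chord_dist (pl_es P) (pl_es Q) \<le> 2 * plane_angle (long_plane P) (long_plane Q)"
proof -
  have n: "norm (pl_es P) = 1" "norm (pl_es Q) = 1" using assms by (auto simp: orthonormal_frame_def)
  have "(chord_dist (pl_es P) (pl_es Q))\<^sup>2 \<le> 2\<^sup>2" unfolding chord_dist_sq[OF n] by simp
  then have "chord_dist (pl_es P) (pl_es Q) \<le> 2" by (rule power2_le_imp_le) simp
  moreover have "0 \<le> chord_dist (pl_es P) (pl_es Q)" by (simp add: chord_dist_def)
  ultimately show ?thesis
    unfolding plane_angle_long_plane[OF assms] using chord_dist_le_arccos[OF n] by linarith
qed

lemma plane_angle_le_chord_dist: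
  assumes "orthonormal_frame P" "orthonormal_frame Q"
  shows "plane_angle (long_plane P) (long_plane Q) \<le> 2 * chord_dist (pl_es P) (pl_es Q)"
proof -
  have n: "norm (pl_es P) = 1" "norm (pl_es Q) = 1" using assms by (auto simp: orthonormal_frame_def)
  show ?thesis unfolding plane_angle_long_plane[OF assms] using arccos_le_chord_dist[OF n] by linarith
qed

text \<open>
  The labels within \<open>\<kappa>\<close> of a given one have pairwise chordal distance at most \<open>2 \<kappa>\<close>, so angular
  diameter at most \<open>4 \<kappa>\<close>; there must be fewer than \<open>a\<close> of them.
\<close>

lemma many_transverse_partners:
  assumes S: "finite S" "i \<in> S" "\<And>j. j \<in> S \<Longrightarrow> orthonormal_frame (P j)"
    and \<kappa>: "0 < \<kappa>"
    and narrow: "\<And>S'. S' \<subseteq> S \<Longrightarrow> a \<le> real (card S') \<Longrightarrow> 4 * \<kappa> < angular_diameter P S'"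
  shows "real (card S) - a \<le> real (card {j \<in> S. \<kappa> \<le> chord_dist (pl_es (P i)) (pl_es (P j))})"
proof -
  let ?near = "{j \<in> S. chord_dist (pl_es (P i)) (pl_es (P j)) < \<kappa>}" and ?far = "{j \<in> S. \<kappa> \<le> chord_dist (pl_es (P i)) (pl_es (P j))}"
  have "angular_diameter P ?near \<le> 4 * \<kappa>"
  proof (rule angular_diameter_le)
    show "?near \<noteq> {}" using S \<kappa> by auto
    fix j k assume jk: "j \<in> ?near" "k \<in> ?near"
    then have "chord_dist (pl_es (P j)) (pl_es (P k)) \<le> 2 * \<kappa>"
      using chord_dist_triangle[of "pl_es (P j)" "pl_es (P k)" "pl_es (P i)"]
        chord_dist_commute[of "pl_es (P j)" "pl_es (P i)"] by auto
    then show "plane_angle (long_plane (P j)) (long_plane (P k)) \<le> 4 * \<kappa>"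
      using plane_angle_le_chord_dist[of "P j" "P k"] S(3) jk by force
  qed (use S in auto)
  then have "real (card ?near) < a" using narrow[of ?near] by force
  moreover have "card S = card (?near \<union> ?far)" by (rule arg_cong[where f = card]) auto
  then have "card S \<le> card ?near + card ?far" using card_Un_le[of ?near ?far] by linarith
  ultimately show ?thesis by linarith
qed

section \<open>Negligible powers of the scale\<close>

lemma ln_inverse_at_top: "filterlim (\<lambda>x::real. ln (1 / x)) at_top (at_right 0)"
proof -
  have "filterlim (\<lambda>x::real. - ln x) at_top (at_right 0)"
    using ln_at_0 by (simp add: filterlim_uminus_at_top)
  moreover have "\<forall>\<^sub>F x::real in at_right 0. - ln x = ln (1 / x)"
    by (intro eventually_at_right_less[THEN eventually_mono]) (simp add: ln_div)
  ultimately show ?thesis by (rule filterlim_cong[OF refl refl, THEN iffD1, rotated])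
qed

lemma tendsto_const_over_ln: "((\<lambda>x::real. k / ln (1 / x)) \<longlongrightarrow> 0) (at_right 0)"
  by (rule tendsto_divide_0[OF tendsto_const filterlim_at_top_imp_at_infinity[OF ln_inverse_at_top]])

lemma tendsto_omega_fill: "(omega_fill c \<longlongrightarrow> 0) (at_right 0)"
  unfolding omega_fill_def by (rule tendsto_const_over_ln)

lemma powr_omega_fill:
  assumes "0 < c" "0 < \<alpha>" "\<alpha> < 1"
  shows "\<alpha> powr omega_fill c \<alpha> = c"
proof -
  have "omega_fill c \<alpha> * ln \<alpha> = ln c"
    using assms by (simp add: omega_fill_def ln_div)
  then show ?thesis using assms by (simp add: powr_def)
qed

lemma delta_max_mono:
  assumes "finite I" "I' \<subseteq> I"
  shows "delta_max I' P \<le> delta_max I P"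
  unfolding delta_max_def using assms
  by (intro SUP_mono' divide_right_mono_ennreal sum_mono2) auto

lemma subpolynomial_factor:
  fixes A B :: "real \<Rightarrow> real"
  assumes "\<And>\<alpha>. 0 < \<alpha> \<Longrightarrow> \<alpha> \<le> 1 \<Longrightarrow> A \<alpha> \<ge> 2" "\<And>\<alpha>. 0 < \<alpha> \<Longrightarrow> \<alpha> \<le> 1 \<Longrightarrow> B \<alpha> \<ge> 2"
    and o: "(\<lambda>\<alpha>. ln (A \<alpha>) + ln (B \<alpha>)) \<in> o[at_right 0](\<lambda>\<alpha>. ln (1 / \<alpha>))"
  shows "((\<lambda>\<alpha>. (ln (B \<alpha>) + k) / ln (1 / \<alpha>)) \<longlongrightarrow> 0) (at_right 0)"
proof -
  have ev: "\<forall>\<^sub>F \<alpha>::real in at_right 0. 0 < \<alpha> \<and> \<alpha> < 1"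
    by (auto simp: eventually_at_right_field intro: exI[of _ 1])
  have lim: "((\<lambda>\<alpha>. (ln (A \<alpha>) + ln (B \<alpha>)) / ln (1 / \<alpha>)) \<longlongrightarrow> 0) (at_right 0)"
    using o by (rule smalloD_tendsto)
  have "((\<lambda>\<alpha>. ln (B \<alpha>) / ln (1 / \<alpha>)) \<longlongrightarrow> 0) (at_right 0)"
  proof (rule tendsto_sandwich[OF _ _ tendsto_const lim])
    show "\<forall>\<^sub>F \<alpha> in at_right 0. 0 \<le> ln (B \<alpha>) / ln (1 / \<alpha>)"
      using ev
    proof eventually_elim
      case (elim \<alpha>)
      then show ?case using assms(2)[of \<alpha>] by (intro divide_nonneg_nonneg) auto
    qed
    show "\<forall>\<^sub>F \<alpha> in at_right 0. ln (B \<alpha>) / ln (1 / \<alpha>) \<le> (ln (A \<alpha>) + ln (B \<alpha>)) / ln (1 / \<alpha>)"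
      using ev
    proof eventually_elim
      case (elim \<alpha>)
      then show ?case using assms(1)[of \<alpha>] by (intro divide_right_mono) auto
    qed
  qed
  from tendsto_add[OF this tendsto_const_over_ln[of k]] show ?thesis
    by (simp add: add_divide_distrib)
qed

section \<open>Filling of balls\<close>

text \<open>
  The constant \<open>c\<close> is chosen so that \<open>\<sigma> = c \<alpha>\<^sup>\<eta>\<close> makes \<open>m\<close> times the measure of the sparse part
  at most a quarter of the mass: \<open>2664 = 4 * 666\<close>, one factor of \<open>C_box\<close> comes from the
  thickness of the planks and three from the lower bound \<open>\<alpha> \<rho> / C_box\<^sup>3\<close> for their volumes. The
  bound \<open>A \<ge> 4\<close> ensures that at most half of the labels at a point are close to a given one.
\<close>

lemma filled_balls_at_scale:
  fixes \<eta> C_box C_d A B c \<alpha> \<rho> \<theta> m :: real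
  assumes c: "c = 1 / (2664 * C_box^4 * cells_per_plank C_box (2 * C_d))"
    and bounds: "C_box \<ge> 1" "C_d \<ge> 1" "A \<ge> 4" "B \<ge> 2"
    and \<alpha>: "0 < \<alpha>" and \<rho>: "\<alpha> \<le> \<rho>" "\<rho> \<le> 1"
    and fam: "shaded_family C_box \<alpha> \<rho> z I P Y"
    and density: "\<alpha> powr \<eta> \<le> shading_density I P Y"
    and m: "0 < m" "\<And>x. x \<in> shaded_union I Y \<Longrightarrow> (\<Sum>i\<in>I. indicator (Y i) x) \<in> {m..<2 * m}"
    and \<theta>: "0 < \<theta>" "\<theta> \<le> 1" "2 * B * \<alpha> \<le> \<theta> * \<rho>"
    and diam: "\<And>x. x \<in> shaded_union I Y \<Longrightarrow> angular_diameter P (incident I Y x) \<le> C_d * \<theta>"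
    and spread: "\<And>x S. x \<in> shaded_union I Y \<Longrightarrow> S \<subseteq> incident I Y x \<Longrightarrow> real (card S) \<ge> 2 * m / A \<Longrightarrow>
        angular_diameter P S > \<theta> / B"
  obtains Y' where "labelled_refinement I Y I Y'" "shaded_mass I Y / 4 \<le> shaded_mass I Y'"
    "\<And>y. shaded_union I Y' \<inter> cball y (\<theta> * \<rho>) \<noteq> {} \<Longrightarrow>
       c\<^sup>2 * \<alpha> powr (2 * \<eta>) / (512 * B)
         \<le> measure lebesgue (shaded_union I Y' \<inter> cball y (4 * (\<theta> * \<rho>))) / measure lebesgue (cball y (4 * (\<theta> * \<rho>)))"
proof -
  have fin: "finite I" using fam by (simp add: shaded_family_def)
  have plank: "comparable_plank C_box \<alpha> \<rho> (P i)" "carrier_of (P i) \<subseteq> cball z 1"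
    "Y i \<in> sets lebesgue" "Y i \<subseteq> carrier_of (P i)" if "i \<in> I" for i
    using fam that by (auto simp: shaded_family_def)
  have frame: "orthonormal_frame (P i)" if "i \<in> I" for i
    using plank(1)[OF that] by (simp add: comparable_plank_def)
  have card: "(\<Sum>i\<in>I. indicator (Y i) x) = real (card (incident I Y x))" for x
    using fin by (simp add: indicator_def sum.If_cases incident_def Int_def)
  have mult: "m \<le> real (card (incident I Y x))" "real (card (incident I Y x)) < 2 * m"
    if "x \<in> shaded_union I Y" for x
    using m(2)[OF that] unfolding card by auto
  have fI: "finite (incident I Y x)" "\<And>i. i \<in> incident I Y x \<Longrightarrow> i \<in> I" for x
    using fin by (auto simp: incident_def)
  interpret transverse_planks C_box "2 * C_d" \<alpha> \<rho> \<theta> B m I P Y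
  proof
    show "Y i \<in> lmeasurable" if "i \<in> I" for i
      using plank[OF that] by (intro bounded_set_imp_lmeasurable) (auto intro: bounded_subset[OF bounded_cball])
    show "\<alpha> \<le> \<theta> * \<rho>"
    proof -
      have "1 * \<alpha> \<le> 2 * B * \<alpha>" using bounds \<alpha> by (intro mult_right_mono) auto
      then show ?thesis using \<theta>(3) by linarith
    qed
    fix x i assume x: "x \<in> shaded_union I Y" and i: "i \<in> incident I Y x"
    show "chord_dist (pl_es (P i)) (pl_es (P j)) \<le> 2 * C_d * \<theta>" if j: "j \<in> incident I Y x" for j
    proof -
      have "chord_dist (pl_es (P i)) (pl_es (P j)) \<le> 2 * plane_angle (long_plane (P i)) (long_plane (P j))"
        using frame fI(2) i j by (intro chord_dist_le_plane_angle) blast+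
      also have "\<dots> \<le> 2 * (C_d * \<theta>)"
        using plane_angle_le_angular_diameter[OF fI(1) i j, of P] diam[OF x] by linarith
      finally show ?thesis by simp
    qed
    have "real (card (incident I Y x)) - 2 * m / A
        \<le> real (card {j \<in> incident I Y x. \<theta> / (4 * B) \<le> chord_dist (pl_es (P i)) (pl_es (P j))})"
    proof (rule many_transverse_partners[OF fI(1) i])
      show "orthonormal_frame (P j)" if "j \<in> incident I Y x" for j using frame fI(2) that by blast
      show "4 * (\<theta> / (4 * B)) < angular_diameter P S'" if "S' \<subseteq> incident I Y x" "2 * m / A \<le> real (card S')" for S'
        using spread[OF x that] by simp
    qed (use \<theta> bounds in auto)
    moreover have "2 * m / A \<le> m / 2" using bounds m by (simp add: field_simps)
    ultimately show "m / 2 \<le> real (card {j \<in> incident I Y x. \<theta> / (4 * B) \<le> chord_dist (pl_es (P i)) (pl_es (P j))})"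
      using mult(1)[OF x] by linarith
  qed (use fin plank \<alpha> \<rho> \<theta> bounds m mult in auto)
  let ?k = "cells_per_plank C_box (2 * C_d)"
  have k: "0 < ?k" using bounds by (simp add: cells_per_plank_def add_pos_pos)
  define \<sigma> where "\<sigma> = c * \<alpha> powr \<eta>"
  have c0: "0 < c" unfolding c using k bounds by simp
  have \<sigma>0: "0 \<le> \<sigma>" using c0 by (simp add: \<sigma>_def)
  have vol: "\<alpha> * \<rho> / C_box^3 \<le> measure lebesgue (carrier_of (P i))" if "i \<in> I" for i
  proof -
    have "\<alpha> * \<rho> / C_box^3 = inverse C_box * \<alpha> * (inverse C_box * \<rho>) * inverse C_box"
      using bounds by (simp add: field_simps power3_eq_cube)
    also have "\<dots> \<le> pl_a (P i) * pl_b (P i) * pl_l (P i)"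
      using plank(1)[OF that] bounds \<alpha> \<rho> sides[OF that]
      by (intro mult_mono) (auto simp: comparable_plank_def)
    also have "\<dots> = measure lebesgue (carrier_of (P i))"
      using sides[OF that] frame[OF that] by (intro carrier_volume[symmetric]) auto
    finally show ?thesis .
  qed
  define V where "V = (\<Sum>i\<in>I. measure lebesgue (carrier_of (P i)))"
  have pw: "0 < \<alpha> powr \<eta>" using \<alpha> by simp
  have "V \<noteq> 0" using density pw by (auto simp: shading_density_def V_def)
  moreover have "0 \<le> V" unfolding V_def by (intro sum_nonneg) auto
  ultimately have V0: "0 < V" by simp
  have "\<alpha> powr \<eta> * (real (card I) * (\<alpha> * \<rho> / C_box^3)) \<le> \<alpha> powr \<eta> * V"
    unfolding V_def using pw sum_mono[of I "\<lambda>_. \<alpha> * \<rho> / C_box^3", OF vol]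
    by (intro mult_left_mono) auto
  also have "\<dots> \<le> shaded_mass I Y"
    using density V0 by (simp add: shading_density_def V_def[symmetric] pos_le_divide_eq)
  finally have mass: "\<alpha> powr \<eta> * (real (card I) * (\<alpha> * \<rho> / C_box^3)) \<le> shaded_mass I Y" .
  have eq: "666 * C_box * ?k * \<sigma> * (\<alpha> * \<rho> * real (card I)) = \<alpha> powr \<eta> * (real (card I) * (\<alpha> * \<rho> / C_box^3)) / 4"
    unfolding \<sigma>_def c using k bounds by (simp add: field_simps power3_eq_cube power4_eq_xxxx)
  have small: "666 * C_box * ?k * \<sigma> * (\<alpha> * \<rho> * real (card I)) \<le> shaded_mass I Y / 4"
    unfolding eq using mass by (rule divide_right_mono) simp
  define W where "W = dense_part (\<sigma>\<^sup>2 / B)"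
  have WU: "W \<subseteq> shaded_union I Y" by (auto simp: W_def dense_part_def)
  then have union: "shaded_union I (\<lambda>i. Y i \<inter> W) = W" by (auto simp: shaded_union_def)
  show ?thesis
  proof
    show "labelled_refinement I Y I (\<lambda>i. Y i \<inter> W)"
      using plank(3) dense_part_sets by (auto simp: labelled_refinement_def W_def)
    show "shaded_mass I Y / 4 \<le> shaded_mass I (\<lambda>i. Y i \<inter> W)"
      unfolding W_def using mult(2) by (intro dense_part_keeps_mass[OF _ \<sigma>0 small] less_imp_le)
    fix y assume meets: "shaded_union I (\<lambda>i. Y i \<inter> W) \<inter> cball y (\<theta> * \<rho>) \<noteq> {}"
    have "(\<alpha> powr \<eta>)\<^sup>2 = \<alpha> powr (2 * \<eta>)"
      by (simp add: power2_eq_square powr_add[symmetric])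
    then have "c\<^sup>2 * \<alpha> powr (2 * \<eta>) / (512 * B) = \<sigma>\<^sup>2 / B / 512"
      by (simp add: \<sigma>_def power_mult_distrib)
    also have "\<dots> \<le> measure lebesgue (W \<inter> cball y (4 * (\<theta> * \<rho>))) / measure lebesgue (cball y (4 * (\<theta> * \<rho>)))"
      unfolding W_def
    proof (rule dense_part_fills_balls)
      show "dense_part (\<sigma>\<^sup>2 / B) \<inter> cball y (\<theta> * \<rho>) \<noteq> {}" using meets[unfolded union, unfolded W_def] .
    qed (use bounds in simp)
    finally show "c\<^sup>2 * \<alpha> powr (2 * \<eta>) / (512 * B)
        \<le> measure lebesgue (shaded_union I (\<lambda>i. Y i \<inter> W) \<inter> cball y (4 * (\<theta> * \<rho>))) / measure lebesgue (cball y (4 * (\<theta> * \<rho>)))"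
      unfolding union .
  qed
qed

theorem theoremC4:
  fixes \<eta> C_comp C_box C_d :: real and A_ang B_ang :: "real \<Rightarrow> real"
  assumes "\<eta> > 0" and "C_comp \<ge> 1" and "C_box \<ge> 1" and "C_d \<ge> 1"
    and "\<And>\<alpha>. 0 < \<alpha> \<Longrightarrow> \<alpha> \<le> 1 \<Longrightarrow> A_ang \<alpha> \<ge> 2"
    and "\<And>\<alpha>. 0 < \<alpha> \<Longrightarrow> \<alpha> \<le> 1 \<Longrightarrow> B_ang \<alpha> \<ge> 2"
    and "(\<lambda>\<alpha>. ln (A_ang \<alpha>) + ln (B_ang \<alpha>)) \<in> o[at_right 0](\<lambda>\<alpha>. ln (1 / \<alpha>))"
    and "\<And>C :: real. filterlim (\<lambda>\<alpha>. A_ang \<alpha> / (ln (2 / \<alpha>) powr C)) at_top (at_right 0)"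
  shows
    "(\<exists>\<alpha>\<^sub>0 C' c_fill. \<exists>\<omega> :: real \<Rightarrow> real.
        \<alpha>\<^sub>0 > 0 \<and> C' \<ge> 1 \<and> 0 < c_fill \<and> c_fill \<le> 1 \<and>
        (\<omega> \<longlongrightarrow> 0) (at_right 0) \<and>
        (omega_fill c_fill \<longlongrightarrow> 0) (at_right 0) \<and>
        (\<forall>\<alpha> \<rho> \<theta> m :: real. \<forall>z I P Y.
           0 < \<alpha> \<and> \<alpha> \<le> \<alpha>\<^sub>0 \<and> \<alpha> \<le> \<rho> \<and> \<rho> \<le> 1 \<and>
           shaded_family C_box \<alpha> \<rho> z I P Y \<and>
           real (card I) \<le> \<alpha> powr (- C_comp) \<and>
           shading_density I P Y \<ge> \<alpha> powr \<eta> \<and>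
           shading_multiplicity I Y \<ge> \<alpha> powr (- \<eta>) \<and>
           m > 0 \<and>
           (\<forall>x\<in>shaded_union I Y.
              (\<Sum>i\<in>I. indicator (Y i) x) \<in> {m..<2 * m}) \<and>
           0 < \<theta> \<and> \<theta> \<le> 1 \<and>
           (\<forall>x\<in>shaded_union I Y.
              angular_diameter P (incident I Y x) \<le> C_d * \<theta> \<and>
              (\<forall>S. S \<subseteq> incident I Y x \<and> real (card S) \<ge> 2 * m / A_ang \<alpha> \<longrightarrow>
                 angular_diameter P S > \<theta> / B_ang \<alpha>)) \<and>
           \<theta> * \<rho> \<ge> 2 * B_ang \<alpha> * \<alpha>
           \<longrightarrow>
           (\<exists>I' Y'. labelled_refinement I Y I' Y' \<and>
              shaded_mass I' Y' \<ge> \<alpha> powr (omega_fill c_fill \<alpha>) * shaded_mass I Y \<and>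
              (\<forall>y. shaded_union I' Y' \<inter> cball y (\<theta> * \<rho>) \<noteq> {} \<longrightarrow>
                 measure lebesgue (shaded_union I' Y' \<inter> cball y (C' * (\<theta> * \<rho>)))
                     / measure lebesgue (cball y (C' * (\<theta> * \<rho>)))
                   \<ge> \<alpha> powr (4 * \<eta> + \<omega> \<alpha>))))) \<and>
     (\<forall>I I' P. finite I \<and> I' \<subseteq> I \<longrightarrow> delta_max I' P \<le> delta_max I P)"
  (is "?filled \<and> ?monotone")
proof
  show ?monotone using delta_max_mono by blast
next
  have Bge: "A_ang \<alpha> \<ge> 2" "B_ang \<alpha> \<ge> 2" if "0 < \<alpha>" "\<alpha> \<le> 1" for \<alpha>
    using assms(5,6) that by auto
  define c where "c = 1 / (2664 * C_box^4 * cells_per_plank C_box (2 * C_d))"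
  have c0: "0 < c"
    unfolding c_def using assms(3,4) by (simp add: cells_per_plank_def add_pos_pos)
  have "\<forall>\<^sub>F \<alpha> in at_right 0. 4 \<le> A_ang \<alpha> / (ln (2 / \<alpha>) powr 0)"
    using assms(8)[of 0] by (simp add: filterlim_at_top)
  then obtain b where b: "0 < b" "\<And>\<alpha>. 0 < \<alpha> \<Longrightarrow> \<alpha> < b \<Longrightarrow> 4 \<le> A_ang \<alpha> / (ln (2 / \<alpha>) powr 0)"
    by (auto simp: eventually_at_right_field)
  define \<alpha>\<^sub>0 where "\<alpha>\<^sub>0 = min (b / 2) (1 / 2)"
  \<comment> \<open>Chosen so that \<open>\<alpha> powr \<omega> \<alpha> = c\<^sup>2 / (512 * B_ang \<alpha>)\<close>.\<close>
  define \<omega> where "\<omega> = (\<lambda>\<alpha>. (ln (B_ang \<alpha>) + ln (512 / c\<^sup>2)) / ln (1 / \<alpha>))"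
  have A4: "4 \<le> A_ang \<alpha>" if "0 < \<alpha>" "\<alpha> \<le> \<alpha>\<^sub>0" for \<alpha>
  proof -
    have "ln (2 / \<alpha>) \<noteq> 0" using that by (simp add: \<alpha>\<^sub>0_def)
    then show ?thesis using b(2)[of \<alpha>] b(1) that by (simp add: \<alpha>\<^sub>0_def)
  qed
  have final: "\<alpha> powr (4 * \<eta> + \<omega> \<alpha>) \<le> c\<^sup>2 * \<alpha> powr (2 * \<eta>) / (512 * B_ang \<alpha>)" if \<alpha>: "0 < \<alpha>" "\<alpha> \<le> \<alpha>\<^sub>0" for \<alpha>
  proof -
    have \<alpha>1: "\<alpha> < 1" using \<alpha> by (simp add: \<alpha>\<^sub>0_def)
    have B0: "0 < B_ang \<alpha>" using Bge(2)[of \<alpha>] \<alpha> \<alpha>1 by simp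
    have "ln \<alpha> \<noteq> 0" using \<alpha> \<alpha>1 by simp
    then have "\<omega> \<alpha> * ln \<alpha> = - (ln (B_ang \<alpha>) + ln (512 / c\<^sup>2))"
      using \<alpha> by (simp add: \<omega>_def ln_div)
    also have "\<dots> = ln (c\<^sup>2 / (512 * B_ang \<alpha>))"
      using B0 c0 by (simp add: ln_div ln_mult)
    finally have "\<alpha> powr \<omega> \<alpha> = c\<^sup>2 / (512 * B_ang \<alpha>)"
      using \<alpha> B0 c0 by (simp add: powr_def)
    moreover have "\<alpha> powr (4 * \<eta>) \<le> \<alpha> powr (2 * \<eta>)"
      using \<alpha> \<alpha>1 assms(1) by (intro powr_mono') auto
    then have "\<alpha> powr (4 * \<eta>) * (c\<^sup>2 / (512 * B_ang \<alpha>)) \<le> \<alpha> powr (2 * \<eta>) * (c\<^sup>2 / (512 * B_ang \<alpha>))"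
      using B0 by (intro mult_right_mono) auto
    ultimately show ?thesis by (simp add: powr_add mult.commute)
  qed
  show ?filled
  proof (rule exI[of _ \<alpha>\<^sub>0], rule exI[of _ 4], rule exI[of _ "1/4"], rule exI[of _ \<omega>],
      intro conjI allI impI; (elim conjE)?)
    show "\<alpha>\<^sub>0 > 0" using b(1) by (simp add: \<alpha>\<^sub>0_def)
    show "(\<omega> \<longlongrightarrow> 0) (at_right 0)"
      unfolding \<omega>_def by (rule subpolynomial_factor[OF assms(5-7)])
    show "(omega_fill (1/4) \<longlongrightarrow> 0) (at_right 0)" by (rule tendsto_omega_fill)
  next
    fix \<alpha> \<rho> \<theta> m :: real and z I P Y
    assume \<alpha>: "0 < \<alpha>" "\<alpha> \<le> \<alpha>\<^sub>0" and \<rho>: "\<alpha> \<le> \<rho>" "\<rho> \<le> 1"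
      and fam: "shaded_family C_box \<alpha> \<rho> z I P Y" and density: "\<alpha> powr \<eta> \<le> shading_density I P Y"
      and m: "0 < m" "\<forall>x\<in>shaded_union I Y. (\<Sum>i\<in>I. indicator (Y i) x) \<in> {m..<2 * m}"
      and \<theta>: "0 < \<theta>" "\<theta> \<le> 1" "2 * B_ang \<alpha> * \<alpha> \<le> \<theta> * \<rho>"
      and angles: "\<forall>x\<in>shaded_union I Y.
              angular_diameter P (incident I Y x) \<le> C_d * \<theta> \<and>
              (\<forall>S. S \<subseteq> incident I Y x \<and> real (card S) \<ge> 2 * m / A_ang \<alpha> \<longrightarrow>
                 angular_diameter P S > \<theta> / B_ang \<alpha>)"
    have \<alpha>1: "\<alpha> < 1" using \<alpha> by (simp add: \<alpha>\<^sub>0_def)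
    obtain Y' where Y': "labelled_refinement I Y I Y'" "shaded_mass I Y / 4 \<le> shaded_mass I Y'"
      "\<And>y. shaded_union I Y' \<inter> cball y (\<theta> * \<rho>) \<noteq> {} \<Longrightarrow>
         c\<^sup>2 * \<alpha> powr (2 * \<eta>) / (512 * B_ang \<alpha>)
           \<le> measure lebesgue (shaded_union I Y' \<inter> cball y (4 * (\<theta> * \<rho>))) / measure lebesgue (cball y (4 * (\<theta> * \<rho>)))"
      using filled_balls_at_scale[OF c_def assms(3,4) A4[OF \<alpha>] Bge(2)[OF \<alpha>(1) less_imp_le[OF \<alpha>1]] \<alpha>(1) \<rho>
        fam density m(1) _ \<theta>] m(2) angles by blast
    show "\<exists>I' Y'. labelled_refinement I Y I' Y' \<and>
        \<alpha> powr omega_fill (1/4) \<alpha> * shaded_mass I Y \<le> shaded_mass I' Y' \<and>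
        (\<forall>y. shaded_union I' Y' \<inter> cball y (\<theta> * \<rho>) \<noteq> {} \<longrightarrow>
           \<alpha> powr (4 * \<eta> + \<omega> \<alpha>)
             \<le> measure lebesgue (shaded_union I' Y' \<inter> cball y (4 * (\<theta> * \<rho>))) / measure lebesgue (cball y (4 * (\<theta> * \<rho>))))"
    proof (intro exI[of _ I] exI[of _ Y'] conjI allI impI)
      show "\<alpha> powr omega_fill (1/4) \<alpha> * shaded_mass I Y \<le> shaded_mass I Y'"
        using Y'(2) by (subst powr_omega_fill) (use \<alpha>(1) \<alpha>1 in auto)
    qed (use Y' final[OF \<alpha>] in \<open>auto intro: order_trans\<close>)
  qed auto
qed

end
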